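(* Let $\Omega\subset\mathbb{R}^d$ be a nonempty compact set on which Lebesgue measure has full support, and let $K:\Omega\times\Omega\to\mathbb{R}$ be a continuous, symmetric, positive definite kernel with native space $\mathcal{H}(\Omega)$. Let $V\subset\mathcal{H}(\Omega)$ be a closed subspace and let $1\le n\le\dim(V)$ be an integer. Let $\lambda_1\ge\lambda_2\ge\dots>0$ be the eigenvalues of $T$ and $\lambda_{1,V}\ge\lambda_{2,V}\ge\dots>0$ those of $T_V$. Then for every $n$-dimensional subspace $V_n\subseteq V$, $$\|P_{V_n}\|_{L_2(\Omega)}\ge\sqrt{\sum_{j=1}^{\infty}\lambda_j-\sum_{j=1}^{n}\lambda_{j,V}},$$ and $E_{n,V}=\mathrm{span}\{\sqrt{\lambda_{j,V}}\,\varphi_{j,V}: j=1,\dots,n\}$ is the unique optimal subspace, i.e. the unique $n$-dimensional subspace of $V$ attaining equality; uniqueness is understood in the same sense as uniqueness of the eigendecomposition of $T_V$: equality holds for $V_n\subseteq V$ if and only if $V_n=\mathrm{span}\{\varphi_{1,V},\dots,\varphi_{n,V}\}$ for some choice of $L_2(\Omega)$-orthonormal eigenfunctions with $T_V\varphi_{j,V}=\lambda_{j,V}\varphi_{j,V}$. In particular, $$\|P_V\|_{L_2(\Omega)}=\sqrt{\sum_{j=1}^{\infty}\lambda_j-\sum_{j=1}^{\dim V}\lambda_{j,V}} .$$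
   Context: A symmetric kernel $K$ is positive definite if for all finite sets of pairwise distinct points the matrix $[K(x_i,x_j)]_{i,j}$ is positive definite. The native space $\mathcal{H}(\Omega)$ is the unique Hilbert space of real functions on $\Omega$ with reproducing kernel $K$, with inner product $(\cdot,\cdot)$ and norm $\|\cdot\|$; it embeds continuously in $L_2(\Omega)$ (Lebesgue measure). $T:L_2(\Omega)\to L_2(\Omega)$ is $Tf(x)=\int_\Omega K(x,y)f(y)\,dy$, compact, self-adjoint and positive; $\lambda_j$ are its positive eigenvalues in non-increasing order, counted with multiplicity. For a closed subspace $W\subset\mathcal{H}(\Omega)$, $\Pi_{\mathcal{H},W}$ is the $\mathcal{H}(\Omega)$-orthogonal projector onto $W$, and the Power Function is $P_W(x)=\sup_{f\in\mathcal{H}(\Omega),\|f\|\le1}|f(x)-\Pi_{\mathcal{H},W}f(x)|$, $x\in\Omega$. A closed subspace $V$ is itself a reproducing kernel Hilbert space (with the inner product of $\mathcal{H}(\Omega)$) with kernel $K_V(x,y)=\Pi^x_{\mathcal{H},V}\Pi^y_{\mathcal{H},V}K(x,y)$ (projector applied with respect to each variable). $T_V:L_2(\Omega)\to L_2(\Omega)$ is $T_Vf(x)=\int_\Omega K_V(x,y)f(y)\,dy$; $\lambda_{j,V}$ are its positive eigenvalues in non-increasing order, counted with multiplicity ($\dim V$ many, possibly infinitely many), with corresponding $L_2(\Omega)$-orthonormal eigenfunctions $\varphi_{j,V}\in V$. *)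

theory Defs
  imports "HOL-Analysis.Analysis" "HOL-Library.Function_Algebras" "HOL-Library.Extended_Nat"
begin

text \<open>Real-valued functions form a real vector space under the pointwise operations, so that
  \<open>subspace\<close>, \<open>span\<close>, \<open>independent\<close> and \<open>dim\<close> apply to sets of functions.\<close>

instantiation "fun" :: (type, real_vector) real_vector
begin

definition scaleR_fun_def: "scaleR c f = (\<lambda>x. c *\<^sub>R f x)"

instance
  by standard (simp_all add: scaleR_fun_def fun_eq_iff scaleR_add_right scaleR_add_left)

end

lemma scaleR_fun_apply [simp]: "(c *\<^sub>R f) x = c *\<^sub>R f x"
  by (simp add: scaleR_fun_def)

text \<open>A function on \<open>\<Omega>\<close> is represented by its extension by zero to the whole type.\<close>

definition zero_ext :: "'a set \<Rightarrow> ('a \<Rightarrow> real) \<Rightarrow> 'a \<Rightarrow> real" where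
  "zero_ext \<Omega> f = (\<lambda>x. if x \<in> \<Omega> then f x else 0)"

definition symmetric_kernel :: "'a set \<Rightarrow> ('a \<Rightarrow> 'a \<Rightarrow> real) \<Rightarrow> bool" where
  "symmetric_kernel \<Omega> K \<longleftrightarrow> (\<forall>x\<in>\<Omega>. \<forall>y\<in>\<Omega>. K x y = K y x)"

text \<open>Strict positive definiteness of all kernel matrices at pairwise distinct points.\<close>

definition pos_def_kernel :: "'a set \<Rightarrow> ('a \<Rightarrow> 'a \<Rightarrow> real) \<Rightarrow> bool" where
  "pos_def_kernel \<Omega> K \<longleftrightarrow>
     (\<forall>X c. finite X \<and> X \<subseteq> \<Omega> \<and> (\<exists>x\<in>X. c x \<noteq> 0) \<longrightarrow>
        0 < (\<Sum>x\<in>X. \<Sum>y\<in>X. c x * c y * K x y))"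

definition full_support :: "'a::euclidean_space set \<Rightarrow> bool" where
  "full_support \<Omega> \<longleftrightarrow> (\<forall>U. open U \<and> U \<inter> \<Omega> \<noteq> {} \<longrightarrow> emeasure lebesgue (U \<inter> \<Omega>) > 0)"


definition ip_norm :: "('v \<Rightarrow> 'v \<Rightarrow> real) \<Rightarrow> 'v \<Rightarrow> real" where
  "ip_norm ip f = sqrt (ip f f)"

definition inner_product_on :: "'v::real_vector set \<Rightarrow> ('v \<Rightarrow> 'v \<Rightarrow> real) \<Rightarrow> bool" where
  "inner_product_on H ip \<longleftrightarrow>
     (\<forall>f\<in>H. \<forall>g\<in>H. ip f g = ip g f) \<and>
     (\<forall>f\<in>H. \<forall>g\<in>H. \<forall>h\<in>H. ip (f + g) h = ip f h + ip g h) \<and>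
     (\<forall>c. \<forall>f\<in>H. \<forall>g\<in>H. ip (c *\<^sub>R f) g = c * ip f g) \<and>
     (\<forall>f\<in>H. 0 \<le> ip f f) \<and>
     (\<forall>f\<in>H. ip f f = 0 \<longrightarrow> f = 0)"

definition complete_on :: "'v::real_vector set \<Rightarrow> ('v \<Rightarrow> 'v \<Rightarrow> real) \<Rightarrow> bool" where
  "complete_on H ip \<longleftrightarrow>
     (\<forall>s :: nat \<Rightarrow> 'v. (\<forall>i. s i \<in> H) \<and>
        (\<forall>e>0. \<exists>N. \<forall>i\<ge>N. \<forall>j\<ge>N. ip_norm ip (s i - s j) < e) \<longrightarrow>
        (\<exists>l\<in>H. (\<lambda>i. ip_norm ip (s i - l)) \<longlonglongrightarrow> 0))"

definition native_space ::
    "'a set \<Rightarrow> ('a \<Rightarrow> 'a \<Rightarrow> real) \<Rightarrow> ('a \<Rightarrow> real) set \<Rightarrow>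
     (('a \<Rightarrow> real) \<Rightarrow> ('a \<Rightarrow> real) \<Rightarrow> real) \<Rightarrow> bool" where
  "native_space \<Omega> K H ip \<longleftrightarrow>
     (\<forall>f\<in>H. \<forall>x. x \<notin> \<Omega> \<longrightarrow> f x = 0) \<and>
     subspace H \<and> inner_product_on H ip \<and> complete_on H ip \<and>
     (\<forall>x\<in>\<Omega>. zero_ext \<Omega> (\<lambda>y. K y x) \<in> H) \<and>
     (\<forall>x\<in>\<Omega>. \<forall>f\<in>H. ip f (zero_ext \<Omega> (\<lambda>y. K y x)) = f x)"

definition closed_subspace :: "'v::real_vector set \<Rightarrow> ('v \<Rightarrow> 'v \<Rightarrow> real) \<Rightarrow> 'v set \<Rightarrow> bool" where
  "closed_subspace H ip W \<longleftrightarrow>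
     subspace W \<and> W \<subseteq> H \<and>
     (\<forall>(s :: nat \<Rightarrow> 'v) l. (\<forall>i. s i \<in> W) \<and> l \<in> H \<and> (\<lambda>i. ip_norm ip (s i - l)) \<longlonglongrightarrow> 0
        \<longrightarrow> l \<in> W)"

text \<open>The library's \<open>dim\<close> is \<open>0\<close> on infinite-dimensional spaces, hence the extended version.\<close>

definition edim :: "'v::real_vector set \<Rightarrow> enat" where
  "edim V = (if \<exists>B. finite B \<and> V \<subseteq> span B then enat (dim V) else \<infinity>)"

definition dim_index :: "'v::real_vector set \<Rightarrow> nat set" where
  "dim_index V = {j. 1 \<le> j \<and> enat j \<le> edim V}"

definition orth_proj :: "('v \<Rightarrow> 'v \<Rightarrow> real) \<Rightarrow> 'v::real_vector set \<Rightarrow> 'v \<Rightarrow> 'v" where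
  "orth_proj ip W f = (THE g. g \<in> W \<and> (\<forall>w\<in>W. ip (f - g) w = 0))"

definition power_function ::
    "('a \<Rightarrow> real) set \<Rightarrow> (('a \<Rightarrow> real) \<Rightarrow> ('a \<Rightarrow> real) \<Rightarrow> real) \<Rightarrow> ('a \<Rightarrow> real) set \<Rightarrow> 'a \<Rightarrow> real" where
  "power_function H ip W x = Sup {\<bar>f x - orth_proj ip W f x\<bar> | f. f \<in> H \<and> ip_norm ip f \<le> 1}"

text \<open>The projector is applied first to \<open>K(s,\<cdot>)\<close> for each fixed \<open>s\<close>, then, with the second
  variable fixed at \<open>y\<close>, to the resulting function of \<open>s\<close>.\<close>

definition subspace_kernel ::
    "'a set \<Rightarrow> ('a \<Rightarrow> 'a \<Rightarrow> real) \<Rightarrow> (('a \<Rightarrow> real) \<Rightarrow> ('a \<Rightarrow> real) \<Rightarrow> real) \<Rightarrow> ('a \<Rightarrow> real) set \<Rightarrow>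
     'a \<Rightarrow> 'a \<Rightarrow> real" where
  "subspace_kernel \<Omega> K ip V x y =
     orth_proj ip V (zero_ext \<Omega> (\<lambda>s. orth_proj ip V (zero_ext \<Omega> (\<lambda>t. K s t)) y)) x"


definition L2 :: "'a::euclidean_space set \<Rightarrow> ('a \<Rightarrow> real) set" where
  "L2 \<Omega> = {f. f \<in> borel_measurable (lebesgue_on \<Omega>) \<and> integrable (lebesgue_on \<Omega>) (\<lambda>x. (f x)\<^sup>2)}"

definition L2_inner :: "'a::euclidean_space set \<Rightarrow> ('a \<Rightarrow> real) \<Rightarrow> ('a \<Rightarrow> real) \<Rightarrow> real" where
  "L2_inner \<Omega> f g = (LINT x|lebesgue_on \<Omega>. f x * g x)"

definition L2_norm :: "'a::euclidean_space set \<Rightarrow> ('a \<Rightarrow> real) \<Rightarrow> real" where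
  "L2_norm \<Omega> f = sqrt (LINT x|lebesgue_on \<Omega>. (f x)\<^sup>2)"

definition int_op :: "'a::euclidean_space set \<Rightarrow> ('a \<Rightarrow> 'a \<Rightarrow> real) \<Rightarrow> ('a \<Rightarrow> real) \<Rightarrow> 'a \<Rightarrow> real" where
  "int_op \<Omega> k f x = (LINT y|lebesgue_on \<Omega>. k x y * f y)"

definition eigenspace ::
    "'a::euclidean_space set \<Rightarrow> ('a \<Rightarrow> 'a \<Rightarrow> real) \<Rightarrow> real \<Rightarrow> ('a \<Rightarrow> real) set" where
  "eigenspace \<Omega> k \<mu> = {f \<in> L2 \<Omega>. AE x in lebesgue_on \<Omega>. int_op \<Omega> k f x = \<mu> * f x}"

text \<open>\<open>S\<close> has dimension \<open>m\<close> modulo equality almost everywhere, i.e. as a subspace of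
  $L_2(\Omega)$: there is an \<open>m\<close>-element basis.\<close>

definition L2_has_dim :: "'a::euclidean_space set \<Rightarrow> ('a \<Rightarrow> real) set \<Rightarrow> nat \<Rightarrow> bool" where
  "L2_has_dim \<Omega> S m \<longleftrightarrow>
     (\<exists>b :: nat \<Rightarrow> 'a \<Rightarrow> real. (\<forall>i<m. b i \<in> S) \<and>
        (\<forall>c. (AE x in lebesgue_on \<Omega>. (\<Sum>i<m. c i * b i x) = 0) \<longrightarrow> (\<forall>i<m. c i = 0)) \<and>
        (\<forall>f\<in>S. \<exists>c. AE x in lebesgue_on \<Omega>. f x = (\<Sum>i<m. c i * b i x)))"

text \<open>\<open>ev\<close>, indexed by \<open>I\<close>, lists the positive eigenvalues of the integral operator with kernel
  \<open>k\<close> in non-increasing order, each repeated according to its multiplicity. A number \<open>\<mu> > 0\<close>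
  that is not an eigenvalue has eigenspace of dimension \<open>0\<close> and so does not occur.\<close>

definition eigenvalue_enum ::
    "'a::euclidean_space set \<Rightarrow> ('a \<Rightarrow> 'a \<Rightarrow> real) \<Rightarrow> nat set \<Rightarrow> (nat \<Rightarrow> real) \<Rightarrow> bool" where
  "eigenvalue_enum \<Omega> k I ev \<longleftrightarrow>
     (\<forall>j\<in>I. ev j > 0) \<and>
     (\<forall>i\<in>I. \<forall>j\<in>I. i \<le> j \<longrightarrow> ev j \<le> ev i) \<and>
     (\<forall>\<mu>>0. finite {j\<in>I. ev j = \<mu>} \<and> L2_has_dim \<Omega> (eigenspace \<Omega> k \<mu>) (card {j\<in>I. ev j = \<mu>}))"

definition eigenfunctions ::
    "'a::euclidean_space set \<Rightarrow> ('a \<Rightarrow> 'a \<Rightarrow> real) \<Rightarrow> ('a \<Rightarrow> real) set \<Rightarrow> nat set \<Rightarrow> (nat \<Rightarrow> real) \<Rightarrow>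
     (nat \<Rightarrow> 'a \<Rightarrow> real) \<Rightarrow> bool" where
  "eigenfunctions \<Omega> k V I ev \<phi> \<longleftrightarrow>
     (\<forall>j\<in>I. \<phi> j \<in> V \<and> \<phi> j \<in> eigenspace \<Omega> k (ev j)) \<and>
     (\<forall>i\<in>I. \<forall>j\<in>I. L2_inner \<Omega> (\<phi> i) (\<phi> j) = (if i = j then 1 else 0))"

end

theory Submission
  imports Defs "HOL-Complex_Analysis.Great_Picard"
begin

text \<open>Write \<open>k\<^sub>x\<close> for the kernel section at \<open>x\<close>.  For a subspace \<open>W\<close> with orthogonal projection \<open>\<Pi>\<close>
  the power function at \<open>x\<close> is the norm of the functional \<open>f \<mapsto> (f - \<Pi> f)(x)\<close>, whose representer is
  \<open>k\<^sub>x - \<Pi> k\<^sub>x\<close>.  By Pythagoras its square is \<open>K x x - \<parallel>\<Pi> k\<^sub>x\<parallel>\<^sup>2\<close>, so everything reduces to two integrals: that of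
  \<open>K x x\<close>, which is the trace of the integral operator, and that of \<open>\<parallel>\<Pi> k\<^sub>x\<parallel>\<^sup>2\<close>.  The latter is the trace
  for \<open>K\<^sub>V\<close> if \<open>W = V\<close>, and \<open>\<Sum>u\<in>U. \<parallel>u\<parallel>\<^sup>2\<close> in the square integrable norm if \<open>W\<close> is spanned by a finite set \<open>U\<close>
  that is orthonormal in the native space.

  The spectral theory is that of a second inner product \<open>q\<close> (here the \<open>L\<^sub>2\<close> product) on a Hilbert space, bounded
  and compact with respect to the first one: \<open>f\<close> is an eigenvector for \<open>\<mu>\<close> when \<open>q f g = \<mu> * ip f g\<close> for all \<open>g\<close>.
  Maximising \<open>q\<close> over a unit sphere produces eigenvectors (\<open>maximizer_exists\<close>), hence the eigenfunctions,
  rescaled by \<open>sqrt \<lambda>\<^sub>j\<close>, form a complete orthonormal system \<open>e\<^sub>j\<close> (\<open>native_basis_complete\<close>).  Summing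
  \<open>e\<^sub>j(x)\<^sup>2\<close> gives \<open>k x x\<close>, and integration gives \<open>trace_formula\<close>.  A closed subspace \<open>V\<close> with the kernel
  \<open>K\<^sub>V\<close> is again a space of the same kind (\<open>closed_subspace_rkhs\<close>), so the theory applies to \<open>V\<close> as well as to
  the whole native space.

  For the extremal problem put \<open>w\<^sub>j = \<Sum>u\<in>U. (ip u e\<^sub>j)\<^sup>2\<close>, the squared length of the projection of \<open>e\<^sub>j\<close> onto \<open>span U\<close>.
  Then \<open>0 \<le> w\<^sub>j \<le> 1\<close>, the \<open>w\<^sub>j\<close> add up to \<open>n\<close> and \<open>\<Sum>u\<in>U. q u u = \<Sum>j. \<lambda>\<^sub>j * w\<^sub>j\<close>; this is largest when the
  weight sits on the \<open>n\<close> largest eigenvalues (\<open>Ky_Fan\<close>).  Equality forces \<open>span U\<close> to contain all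
  eigenfunctions with eigenvalue above \<open>\<lambda>\<^sub>n\<close> and to be orthogonal to those below, so only the choice of a subspace
  of the eigenspace of \<open>\<lambda>\<^sub>n\<close> remains free (\<open>Ky_Fan_equality\<close>).\<close>

section \<open>Inner products on a subspace\<close>

text \<open>The carrier is explicit because one type of functions carries several inner products, each of which
  obeys its laws only on a subspace: the native product and the \<open>L\<^sub>2\<close> product, on \<open>H\<close> and on \<open>V\<close>.\<close>

locale ip_space =
  fixes S :: "'v::real_vector set" and ip :: "'v \<Rightarrow> 'v \<Rightarrow> real"
  assumes subspace_S: "subspace S" and ip_on: "inner_product_on S ip"
begin

abbreviation nrm :: "'v \<Rightarrow> real" where "nrm \<equiv> ip_norm ip"

lemmas mem_S = subspace_0[OF subspace_S] subspace_add[OF subspace_S]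
  subspace_diff[OF subspace_S] subspace_scale[OF subspace_S] subspace_sum[OF subspace_S]

lemma ip_comm:
  assumes "f \<in> S" "g \<in> S"
  shows "ip f g = ip g f"
proof -
  have "\<forall>f\<in>S. \<forall>g\<in>S. ip f g = ip g f"
    using ip_on unfolding inner_product_on_def by (rule conjunct1)
  then show ?thesis using assms by blast
qed

lemma ip_add_left: "f \<in> S \<Longrightarrow> g \<in> S \<Longrightarrow> h \<in> S \<Longrightarrow> ip (f + g) h = ip f h + ip g h"
  using ip_on by (simp add: inner_product_on_def)

lemma ip_scale_left: "f \<in> S \<Longrightarrow> g \<in> S \<Longrightarrow> ip (c *\<^sub>R f) g = c * ip f g"
  using ip_on by (simp add: inner_product_on_def)

lemma ip_nonneg: "f \<in> S \<Longrightarrow> 0 \<le> ip f f"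
  using ip_on by (simp add: inner_product_on_def)

lemma ip_definite: "f \<in> S \<Longrightarrow> ip f f = 0 \<Longrightarrow> f = 0"
  using ip_on by (simp add: inner_product_on_def)

lemma ip_add_right: "f \<in> S \<Longrightarrow> g \<in> S \<Longrightarrow> h \<in> S \<Longrightarrow> ip h (f + g) = ip h f + ip h g"
  by (simp add: ip_add_left mem_S ip_comm[of h])

lemma ip_scale_right: "f \<in> S \<Longrightarrow> g \<in> S \<Longrightarrow> ip f (c *\<^sub>R g) = c * ip f g"
  by (simp add: ip_scale_left mem_S ip_comm[of f])

lemma ip_diff_left: "f \<in> S \<Longrightarrow> g \<in> S \<Longrightarrow> h \<in> S \<Longrightarrow> ip (f - g) h = ip f h - ip g h"
  using ip_add_left[of "f - g" g h] mem_S by simp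

lemma ip_diff_right: "f \<in> S \<Longrightarrow> g \<in> S \<Longrightarrow> h \<in> S \<Longrightarrow> ip h (f - g) = ip h f - ip h g"
  using ip_add_right[of "f - g" g h] mem_S by simp

lemma ip_zero_left [simp]: "f \<in> S \<Longrightarrow> ip 0 f = 0"
  using ip_scale_left[of f f 0] by simp

lemma ip_zero_right [simp]: "f \<in> S \<Longrightarrow> ip f 0 = 0"
  using ip_scale_right[of f f 0] by simp

lemma ip_sum_left: "(\<And>i. i \<in> A \<Longrightarrow> u i \<in> S) \<Longrightarrow> g \<in> S \<Longrightarrow> ip (\<Sum>i\<in>A. u i) g = (\<Sum>i\<in>A. ip (u i) g)"
  by (induction A rule: infinite_finite_induct) (auto simp: ip_add_left mem_S)

lemma ip_sum_right: "(\<And>i. i \<in> A \<Longrightarrow> u i \<in> S) \<Longrightarrow> g \<in> S \<Longrightarrow> ip g (\<Sum>i\<in>A. u i) = (\<Sum>i\<in>A. ip g (u i))"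
  by (induction A rule: infinite_finite_induct) (auto simp: ip_add_right mem_S)

lemmas ip_linear = ip_add_left ip_add_right ip_diff_left ip_diff_right ip_scale_left ip_scale_right

lemma nrm_nonneg [simp]: "f \<in> S \<Longrightarrow> 0 \<le> nrm f"
  by (simp add: ip_norm_def ip_nonneg)

lemma nrm_sq: "f \<in> S \<Longrightarrow> (nrm f)\<^sup>2 = ip f f"
  by (simp add: ip_norm_def ip_nonneg)

lemma nrm_zero_iff: "f \<in> S \<Longrightarrow> nrm f = 0 \<longleftrightarrow> f = 0"
  using ip_definite by (auto simp: ip_norm_def)

lemma nrm_scale: "f \<in> S \<Longrightarrow> nrm (c *\<^sub>R f) = \<bar>c\<bar> * nrm f"
  by (simp add: ip_norm_def ip_linear mem_S real_sqrt_mult flip: mult.assoc)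

lemma nrm_minus_commute: "f \<in> S \<Longrightarrow> g \<in> S \<Longrightarrow> nrm (f - g) = nrm (g - f)"
  using nrm_scale[of "g - f" "-1"] mem_S by simp

lemma Cauchy_Schwarz_sq:
  assumes "f \<in> S" "g \<in> S"
  shows "(ip f g)\<^sup>2 \<le> ip f f * ip g g"
proof (cases "g = 0")
  case True
  then show ?thesis using assms by simp
next
  case False
  then have pos: "ip g g > 0"
    using ip_nonneg[of g] ip_definite[of g] assms by force
  let ?c = "ip f g / ip g g"
  have "0 \<le> ip (f - ?c *\<^sub>R g) (f - ?c *\<^sub>R g)"
    using assms by (intro ip_nonneg mem_S)
  also have "\<dots> = ip f f - (ip f g)\<^sup>2 / ip g g"
    using assms pos
    by (simp add: ip_linear mem_S ip_comm[of g f] power2_eq_square field_simps)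
  finally show ?thesis
    using pos by (simp add: field_simps)
qed

lemma Cauchy_Schwarz:
  assumes "f \<in> S" "g \<in> S"
  shows "\<bar>ip f g\<bar> \<le> nrm f * nrm g"
  using real_sqrt_le_mono[OF Cauchy_Schwarz_sq[OF assms]]
  by (simp add: ip_norm_def real_sqrt_mult)

lemma nrm_triangle:
  assumes "f \<in> S" "g \<in> S"
  shows "nrm (f + g) \<le> nrm f + nrm g"
proof (rule power2_le_imp_le)
  have "(nrm (f + g))\<^sup>2 = ip f f + 2 * ip f g + ip g g"
    using assms by (simp add: nrm_sq ip_linear mem_S ip_comm[of g f])
  also have "\<dots> \<le> ip f f + 2 * (nrm f * nrm g) + ip g g"
    using Cauchy_Schwarz[OF assms] by linarith
  also have "\<dots> = (nrm f + nrm g)\<^sup>2"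
    using assms by (simp add: power2_sum nrm_sq)
  finally show "(nrm (f + g))\<^sup>2 \<le> (nrm f + nrm g)\<^sup>2" .
qed (use assms in auto)

lemma nrm_triangle_diff:
  assumes "f \<in> S" "g \<in> S"
  shows "\<bar>nrm f - nrm g\<bar> \<le> nrm (f - g)"
  using nrm_triangle[of "f - g" g] nrm_triangle[of "g - f" f] nrm_minus_commute[of f g] assms mem_S
  by simp

lemma tendsto_ip:
  assumes "\<And>i. s i \<in> S" "l \<in> S" "g \<in> S" "(\<lambda>i. nrm (s i - l)) \<longlonglongrightarrow> 0"
  shows "(\<lambda>i. ip (s i) g) \<longlonglongrightarrow> ip l g"
proof -
  have "(\<lambda>i. ip (s i) g - ip l g) \<longlonglongrightarrow> 0"
  proof (rule Lim_null_comparison)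
    show "\<forall>\<^sub>F i in sequentially. norm (ip (s i) g - ip l g) \<le> nrm (s i - l) * nrm g"
      using Cauchy_Schwarz[of "s _ - l" g] assms mem_S by (auto simp: ip_linear)
    show "(\<lambda>i. nrm (s i - l) * nrm g) \<longlonglongrightarrow> 0"
      using tendsto_mult_left_zero[OF assms(4)] by blast
  qed
  then show ?thesis by (simp add: LIM_zero_iff)
qed

lemma tendsto_nrm:
  assumes "\<And>i. s i \<in> S" "l \<in> S" "(\<lambda>i. nrm (s i - l)) \<longlonglongrightarrow> 0"
  shows "(\<lambda>i. nrm (s i)) \<longlonglongrightarrow> nrm l"
proof -
  have "(\<lambda>i. nrm (s i) - nrm l) \<longlonglongrightarrow> 0"
    by (rule Lim_null_comparison[OF _ assms(3)]) (use nrm_triangle_diff assms in auto)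
  then show ?thesis by (simp add: LIM_zero_iff)
qed

lemma tendsto_ip_self:
  assumes "\<And>i. s i \<in> S" "l \<in> S" "(\<lambda>i. nrm (s i - l)) \<longlonglongrightarrow> 0"
  shows "(\<lambda>i. ip (s i) (s i)) \<longlonglongrightarrow> ip l l"
  using tendsto_power[OF tendsto_nrm[OF assms], of 2] assms by (simp add: nrm_sq)

section \<open>Orthonormal sets\<close>

definition ortho :: "'v set \<Rightarrow> bool" where
  "ortho B \<longleftrightarrow> B \<subseteq> S \<and> (\<forall>a\<in>B. \<forall>b\<in>B. ip a b = (if a = b then 1 else 0))"

definition proj_sum :: "'v set \<Rightarrow> 'v \<Rightarrow> 'v" where
  "proj_sum B f = (\<Sum>b\<in>B. ip f b *\<^sub>R b)"

lemma proj_sum_in_span: "proj_sum B f \<in> span B"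
  unfolding proj_sum_def by (intro span_sum span_scale span_base)

lemma span_ortho_subset: "ortho B \<Longrightarrow> span B \<subseteq> S"
  by (simp add: ortho_def span_minimal subspace_S)

lemma ip_proj_sum:
  assumes "ortho B" "finite B" "f \<in> S" "b \<in> B"
  shows "ip (proj_sum B f) b = ip f b"
proof -
  have "ip (proj_sum B f) b = (\<Sum>a\<in>B. ip f a * (if a = b then 1 else 0))"
    unfolding proj_sum_def using assms
    by (subst ip_sum_left) (auto simp: ortho_def ip_linear mem_S subset_iff intro!: sum.cong)
  also have "\<dots> = ip f b"
    using assms by (simp add: if_distrib[of "(*) _"] cong: if_cong)
  finally show ?thesis .
qed

lemma ip_span_eqI:
  assumes "B \<subseteq> S" "f \<in> S" "g \<in> S" "\<And>b. b \<in> B \<Longrightarrow> ip f b = ip g b" "w \<in> span B"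
  shows "ip f w = ip g w"
proof -
  have "w \<in> S \<and> ip f w = ip g w"
    using assms(5)
  proof (induction rule: span_induct_alt)
    case base then show ?case using assms mem_S by simp
  next
    case (step c x y)
    then show ?case
      using assms by (auto simp: ip_linear mem_S subset_iff)
  qed
  then show ?thesis by simp
qed

lemma proj_sum_orthogonal:
  assumes "ortho B" "finite B" "f \<in> S" "w \<in> span B"
  shows "ip (f - proj_sum B f) w = 0"
proof -
  have B: "B \<subseteq> S" using assms(1) by (simp add: ortho_def)
  have p: "proj_sum B f \<in> S"
    using proj_sum_in_span span_ortho_subset[OF assms(1)] by blast
  have "ip (proj_sum B f) w = ip f w"
    by (rule ip_span_eqI[OF B p assms(3) _ assms(4)]) (simp add: ip_proj_sum assms)
  moreover have "w \<in> S" using assms span_ortho_subset by blast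
  ultimately show ?thesis using assms p by (simp add: ip_linear)
qed

lemma nrm_proj_sum:
  assumes "ortho B" "finite B" "f \<in> S"
  shows "ip (proj_sum B f) (proj_sum B f) = (\<Sum>b\<in>B. (ip f b)\<^sup>2)"
proof -
  have p: "proj_sum B f \<in> S"
    using proj_sum_in_span span_ortho_subset[OF assms(1)] by blast
  have "ip (proj_sum B f) (\<Sum>b\<in>B. ip f b *\<^sub>R b) = (\<Sum>b\<in>B. ip (proj_sum B f) (ip f b *\<^sub>R b))"
    by (rule ip_sum_right) (use assms p in \<open>auto simp: ortho_def subset_iff mem_S\<close>)
  also have "\<dots> = (\<Sum>b\<in>B. (ip f b)\<^sup>2)"
    using assms p by (intro sum.cong)
      (auto simp: ortho_def ip_linear ip_proj_sum subset_iff power2_eq_square)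
  finally show ?thesis by (simp add: proj_sum_def)
qed

lemma residual_proj_sum:
  assumes "ortho B" "finite B" "f \<in> S"
  shows "ip (f - proj_sum B f) (f - proj_sum B f) = ip f f - (\<Sum>b\<in>B. (ip f b)\<^sup>2)"
proof -
  have p: "proj_sum B f \<in> S"
    using proj_sum_in_span span_ortho_subset[OF assms(1)] by blast
  have "ip (f - proj_sum B f) (proj_sum B f) = 0"
    by (rule proj_sum_orthogonal[OF assms proj_sum_in_span])
  then show ?thesis
    using assms p nrm_proj_sum[OF assms] by (simp add: ip_linear mem_S ip_comm[of f "proj_sum B f"])
qed

lemma Bessel:
  assumes "ortho B" "finite B" "f \<in> S"
  shows "(\<Sum>b\<in>B. (ip f b)\<^sup>2) \<le> ip f f"
  using residual_proj_sum[OF assms] ip_nonneg[of "f - proj_sum B f"]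
    proj_sum_in_span[of B f] span_ortho_subset[OF assms(1)] assms mem_S
  by (metis diff_ge_0_iff_ge subsetD)

text \<open>Equality in Bessel's inequality says that the residual of the projection has length zero.\<close>

lemma in_span_if_Bessel_eq:
  assumes "ortho B" "finite B" "f \<in> S" "(\<Sum>b\<in>B. (ip f b)\<^sup>2) = ip f f"
  shows "f \<in> span B"
proof -
  have "proj_sum B f \<in> S"
    using proj_sum_in_span span_ortho_subset[OF assms(1)] by blast
  then have "f - proj_sum B f = 0"
    using residual_proj_sum[OF assms(1-3)] assms mem_S by (intro ip_definite) auto
  then show ?thesis using proj_sum_in_span by (metis eq_iff_diff_eq_0)
qed

lemma ortho_independent:
  assumes "ortho B"
  shows "independent B"
  unfolding independent_explicit_module
proof (intro allI impI)
  fix T c b assume T: "finite T" "T \<subseteq> B" "(\<Sum>v\<in>T. c v *\<^sub>R v) = 0" "b \<in> T"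
  have "0 = ip (\<Sum>v\<in>T. c v *\<^sub>R v) b"
    using T assms by (auto simp: ortho_def)
  also have "\<dots> = (\<Sum>v\<in>T. c v * (if v = b then 1 else 0))"
    using T assms
    by (subst ip_sum_left) (auto simp: ortho_def ip_linear mem_S subset_iff intro!: sum.cong)
  also have "\<dots> = c b" using T by (simp add: if_distrib[of "(*) _"] cong: if_cong)
  finally show "c b = 0" by simp
qed

lemma ortho_insert:
  assumes "ortho B" "finite B" "f \<in> S" "f \<notin> span B"
  obtains g where "ortho (insert g B)" "g \<notin> B" "g \<in> span (insert f B)"
proof -
  define h where "h = f - proj_sum B f"
  have p: "proj_sum B f \<in> S" 
    using proj_sum_in_span span_ortho_subset[OF assms(1)] by blast
  have h: "h \<in> S" using assms p mem_S by (simp add: h_def)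
  have hB: "ip h b = 0" if "b \<in> B" for b
    unfolding h_def by (rule proj_sum_orthogonal[OF assms(1-3) span_base[OF that]])
  have "h \<noteq> 0" using assms(4) proj_sum_in_span by (metis h_def eq_iff_diff_eq_0)
  then have nh: "nrm h \<noteq> 0" using nrm_zero_iff h by blast
  define g where "g = (1 / nrm h) *\<^sub>R h"
  have g: "g \<in> S" using h mem_S by (simp add: g_def)
  have gB: "ip g b = 0" "ip b g = 0" if "b \<in> B" for b
  proof -
    show "ip g b = 0"
      using hB[OF that] that assms(1) h by (auto simp: g_def ip_linear ortho_def subset_iff)
    then show "ip b g = 0"
      using ip_comm[of b g] that assms(1) g by (auto simp: ortho_def)
  qed
  have gg: "ip g g = 1"
    using h nh by (simp add: g_def ip_linear mem_S nrm_sq[OF h, symmetric] power2_eq_square)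
  show ?thesis
  proof
    show "ortho (insert g B)"
      using assms(1) g gB gg unfolding ortho_def by force
    show "g \<notin> B" using gB gg by force
    have "proj_sum B f \<in> span (insert f B)"
      using proj_sum_in_span span_mono[of B "insert f B"] by blast
    then show "g \<in> span (insert f B)"
      unfolding g_def h_def by (intro span_scale span_diff) (auto intro: span_base)
  qed
qed

text \<open>Gram--Schmidt in extremal form: an orthonormal extension of maximal cardinality must span,
  for otherwise one more normalised residual could be added.\<close>

theorem ortho_extend:
  assumes W: "subspace W" "W \<subseteq> S" "finite F" "W \<subseteq> span F"
    and B: "ortho B" "B \<subseteq> W"
  obtains C where "ortho C" "B \<subseteq> C" "finite C" "span C = W" "card C = dim W"
proof -
  have bound: "finite C \<and> card C \<le> card F" if "ortho C" "C \<subseteq> W" for C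
    using independent_span_bound[OF W(3) ortho_independent[OF that(1)]] that W by blast
  define P where "P k \<longleftrightarrow> (\<exists>C. ortho C \<and> B \<subseteq> C \<and> C \<subseteq> W \<and> card C = k)" for k
  have ex: "P (card B)" using B by (auto simp: P_def)
  have le: "\<And>k. P k \<Longrightarrow> k \<le> card F" using bound by (auto simp: P_def)
  obtain k where k: "P k" "\<And>j. P j \<Longrightarrow> j \<le> k"
    using Nat.ex_has_greatest_nat[of P _ "card F"] ex le by blast
  then obtain C where C: "ortho C" "B \<subseteq> C" "C \<subseteq> W" "card C = k" by (auto simp: P_def)
  have fin: "finite C" using bound C by blast
  have "W \<subseteq> span C"
  proof (rule ccontr)
    assume "\<not> W \<subseteq> span C"
    then obtain f where f: "f \<in> W" "f \<notin> span C" by blast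
    obtain g where g: "ortho (insert g C)" "g \<notin> C" "g \<in> span (insert f C)"
      using ortho_insert[OF C(1) fin _ f(2)] f(1) W(2) by blast
    have "g \<in> W" using g(3) f(1) C(3) W(1) span_minimal[of "insert f C" W] by blast
    then have "P (Suc k)" unfolding P_def using g C fin
      by (intro exI[of _ "insert g C"]) auto
    then show False using k(2) by force
  qed
  then have "span C = W" using C(3) W(1) span_minimal by blast
  moreover have "card C = dim W"
    using dim_eq_card[OF _ ortho_independent[OF C(1)]] \<open>span C = W\<close> by (metis span_span)
  ultimately show ?thesis using that C fin by blast
qed

end

section \<open>Hilbert spaces\<close>

locale hilbert = ip_space H ip for H :: "'v::real_vector set" and ip +
  assumes complete: "complete_on H ip"
begin

lemma complete_closed:
  assumes "closed_subspace H ip W" "\<And>i. s i \<in> W"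
    and "\<And>e. e > 0 \<Longrightarrow> \<exists>N. \<forall>i\<ge>N. \<forall>j\<ge>N. nrm (s i - s j) < e"
  obtains l where "l \<in> W" "(\<lambda>i. nrm (s i - l)) \<longlonglongrightarrow> 0"
proof -
  have "\<And>i. s i \<in> H" using assms(1,2) by (auto simp: closed_subspace_def)
  then obtain l where "l \<in> H" "(\<lambda>i. nrm (s i - l)) \<longlonglongrightarrow> 0"
    using complete assms(3) unfolding complete_on_def by metis
  then show ?thesis using that assms unfolding closed_subspace_def by blast
qed

lemma closed_subspace_self: "closed_subspace H ip H"
  by (simp add: closed_subspace_def subspace_S)

end

text \<open>The first-order condition at a minimum of a quadratic functional, used both for representers
  and for maximisers of a form.\<close>

lemma quadratic_nonneg_imp_linear_zero:
  fixes a b :: real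
  assumes "\<And>t. 0 \<le> a * t\<^sup>2 + 2 * b * t" "a \<ge> 0"
  shows "b = 0"
proof (rule ccontr)
  assume b: "b \<noteq> 0"
  \<comment> \<open>the minimum is at \<open>- b / a\<close>; the shift by \<open>1\<close> keeps the denominator positive when \<open>a = 0\<close>\<close>
  have "a * (- b / (a + 1))\<^sup>2 + 2 * b * (- b / (a + 1)) = - ((a + 2) * (b / (a + 1))\<^sup>2)"
    using assms(2) by (simp add: power2_eq_square divide_simps) (simp add: algebra_simps)
  also have "\<dots> < 0" using b assms(2) by (simp add: mult_pos_pos)
  finally show False using assms(1)[of "- b / (a + 1)"] by linarith
qed

context hilbert
begin

lemma complete_closed_sq:
  assumes W: "closed_subspace H ip W" "\<And>i. s i \<in> W"
    and C: "\<And>e. e > 0 \<Longrightarrow> \<exists>N. \<forall>i\<ge>N. \<forall>j\<ge>N. ip (s i - s j) (s i - s j) < e"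
  obtains l where "l \<in> W" "(\<lambda>i. nrm (s i - l)) \<longlonglongrightarrow> 0"
proof (rule complete_closed[OF W])
  fix e :: real assume e: "e > 0"
  then obtain N where N: "\<And>i j. i \<ge> N \<Longrightarrow> j \<ge> N \<Longrightarrow> ip (s i - s j) (s i - s j) < e\<^sup>2"
    using C[of "e\<^sup>2"] by auto
  have "nrm (s i - s j) < e" if "i \<ge> N" "j \<ge> N" for i j
    using real_sqrt_less_mono[OF N[OF that]] e by (simp add: ip_norm_def)
  then show "\<exists>N. \<forall>i\<ge>N. \<forall>j\<ge>N. nrm (s i - s j) < e" by blast
qed (use that in blast)

text \<open>The representer minimises \<open>ip f f - 2 * L f\<close>: a minimising sequence is Cauchy by the parallelogram law, and
  the first-order condition at the limit is the representation property.\<close>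

theorem Riesz:
  assumes W: "closed_subspace H ip W"
    and L_add: "\<And>f g. f \<in> W \<Longrightarrow> g \<in> W \<Longrightarrow> L (f + g) = L f + L g"
    and L_scale: "\<And>c f. f \<in> W \<Longrightarrow> L (c *\<^sub>R f) = c * L f"
    and bound: "\<And>f. f \<in> W \<Longrightarrow> \<bar>L f\<bar> \<le> C * nrm f"
  obtains h where "h \<in> W" "\<And>g. g \<in> W \<Longrightarrow> ip h g = L g"
proof -
  have sW: "subspace W" and WH: "W \<subseteq> H" using W by (auto simp: closed_subspace_def)
  note memW = subspace_0[OF sW] subspace_add[OF sW] subspace_diff[OF sW] subspace_scale[OF sW]
  have inH: "f \<in> H" if "f \<in> W" for f using that WH by blast
  have L_diff: "L (f - g) = L f - L g" if "f \<in> W" "g \<in> W" for f g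
    using L_add[of "f - g" g] that memW by simp
  define J where "J f = ip f f - 2 * L f" for f
  have lower: "- C\<^sup>2 \<le> J f" if "f \<in> W" for f
  proof -
    have "0 \<le> (nrm f - C)\<^sup>2" by simp
    also have "\<dots> = ip f f - 2 * (C * nrm f) + C\<^sup>2"
      using that inH by (simp add: power2_diff nrm_sq)
    also have "\<dots> \<le> J f + C\<^sup>2" using bound[OF that] by (simp add: J_def)
    finally show ?thesis by simp
  qed
  define m where "m = Inf (J ` W)"
  have bdd: "bdd_below (J ` W)" using lower by (auto intro!: bdd_belowI2)
  have m_le: "m \<le> J f" if "f \<in> W" for f
    unfolding m_def using bdd that by (intro cInf_lower) auto
  have "\<exists>f\<in>W. J f < m + 1 / real (Suc i)" for i
  proof -
    have "J ` W \<noteq> {}" using memW by blast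
    then have "\<exists>y\<in>J ` W. y < m + 1 / real (Suc i)"
      unfolding m_def using bdd by (subst cInf_less_iff[symmetric]) auto
    then show ?thesis by blast
  qed
  then obtain s where s: "\<And>i. s i \<in> W" "\<And>i. J (s i) < m + 1 / real (Suc i)" by metis
  have para: "ip (f - g) (f - g) = 2 * J f + 2 * J g - 4 * J ((1/2) *\<^sub>R (f + g))"
    if "f \<in> W" "g \<in> W" for f g
    using that inH memW
    by (simp add: J_def ip_linear mem_S L_add L_scale ip_comm[of g f] field_simps)
  obtain l where l: "l \<in> W" "(\<lambda>i. nrm (s i - l)) \<longlonglongrightarrow> 0"
  proof (rule complete_closed_sq[OF W s(1)])
    fix e :: real assume e: "e > 0"
    obtain N where N: "1 / real (Suc N) < e / 4"
      using reals_Archimedean[of "e/4"] e by (auto simp: inverse_eq_divide)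
    have "ip (s i - s j) (s i - s j) < e" if "i \<ge> N" "j \<ge> N" for i j
    proof -
      have "1 / real (Suc i) \<le> 1 / real (Suc N)" "1 / real (Suc j) \<le> 1 / real (Suc N)"
        using that by (auto intro!: divide_left_mono)
      moreover have "m \<le> J ((1/2) *\<^sub>R (s i + s j))"
        using s(1) memW by (intro m_le) auto
      ultimately show ?thesis
        using para[OF s(1)[of i] s(1)[of j]] s(2)[of i] s(2)[of j] N by linarith
    qed
    then show "\<exists>N. \<forall>i\<ge>N. \<forall>j\<ge>N. ip (s i - s j) (s i - s j) < e" by blast
  qed (use that in blast)
  have "(\<lambda>i. L (s i) - L l) \<longlonglongrightarrow> 0"
  proof (rule Lim_null_comparison)
    show "\<forall>\<^sub>F i in sequentially. norm (L (s i) - L l) \<le> C * nrm (s i - l)"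
      using bound[of "s _ - l"] s(1) l(1) memW by (simp add: L_diff)
    show "(\<lambda>i. C * nrm (s i - l)) \<longlonglongrightarrow> 0"
      using tendsto_mult_right_zero[OF l(2)] by blast
  qed
  then have "(\<lambda>i. L (s i)) \<longlonglongrightarrow> L l" by (simp add: LIM_zero_iff)
  then have "(\<lambda>i. J (s i)) \<longlonglongrightarrow> J l"
    unfolding J_def using s(1) l inH by (intro tendsto_intros tendsto_ip_self) auto
  moreover have "(\<lambda>i. m + 1 / real (Suc i)) \<longlonglongrightarrow> m + 0"
    by (intro tendsto_intros LIMSEQ_Suc[OF lim_1_over_n])
  ultimately have "J l \<le> m + 0"
    by (rule LIMSEQ_le) (use s(2) in \<open>blast intro: less_imp_le\<close>)
  then have Jl: "J l \<le> m" by simp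
  have "ip l g = L g" if g: "g \<in> W" for g
  proof -
    have "0 \<le> ip g g * t\<^sup>2 + 2 * (ip l g - L g) * t" for t
    proof -
      have "J l \<le> J (l + t *\<^sub>R g)" using Jl m_le[of "l + t *\<^sub>R g"] l g memW by force
      also have "\<dots> = J l + (ip g g * t\<^sup>2 + 2 * (ip l g - L g) * t)"
        using l g inH memW
        by (simp add: J_def ip_linear mem_S L_add L_scale ip_comm[of g l] power2_eq_square algebra_simps)
      finally show ?thesis by simp
    qed
    then have "ip l g - L g = 0"
      using g inH ip_nonneg by (intro quadratic_nonneg_imp_linear_zero[of "ip g g"]) auto
    then show ?thesis by simp
  qed
  then show ?thesis using that l by blast
qed

section \<open>Orthogonal projections\<close>

text \<open>Orthogonal projections are needed onto closed subspaces and onto spans of finite orthonormal sets.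
  The property they share is that every vector has a best approximation.\<close>

definition projectable :: "'v set \<Rightarrow> bool" where
  "projectable W \<longleftrightarrow> subspace W \<and> W \<subseteq> H \<and> (\<forall>f\<in>H. \<exists>g\<in>W. \<forall>w\<in>W. ip (f - g) w = 0)"

lemma closed_subspace_projectable:
  assumes W: "closed_subspace H ip W"
  shows "projectable W"
proof -
  have WH: "W \<subseteq> H" using W by (simp add: closed_subspace_def)
  have "\<exists>g\<in>W. \<forall>w\<in>W. ip (f - g) w = 0" if f: "f \<in> H" for f
  proof -
    obtain h where h: "h \<in> W" "\<And>g. g \<in> W \<Longrightarrow> ip h g = ip f g"
      by (rule Riesz[OF W, of "ip f" "nrm f"])
        (use WH f Cauchy_Schwarz in \<open>auto simp: ip_linear subset_iff\<close>)
    then show ?thesis using WH f by (auto simp: ip_linear subset_iff intro!: bexI[of _ h])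
  qed
  then show ?thesis using W by (auto simp: projectable_def closed_subspace_def)
qed

lemma span_ortho_projectable:
  assumes "ortho B" "finite B"
  shows "projectable (span B)"
  unfolding projectable_def
  using span_ortho_subset[OF assms(1)] proj_sum_orthogonal[OF assms] proj_sum_in_span
  by (meson subspace_span)

lemma orth_proj_eqI:
  assumes "projectable W" "f \<in> H" "g \<in> W" "\<And>w. w \<in> W \<Longrightarrow> ip (f - g) w = 0"
  shows "orth_proj ip W f = g"
  unfolding orth_proj_def
proof (rule the_equality)
  fix h assume h: "h \<in> W \<and> (\<forall>w\<in>W. ip (f - h) w = 0)"
  have WH: "g \<in> H" "h \<in> H" "h - g \<in> H" and d: "h - g \<in> W"
    using assms h mem_S by (auto simp: projectable_def subspace_diff)
  have "ip (f - g) (h - g) = 0" "ip (f - h) (h - g) = 0" using d h assms(4) by auto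
  then have "ip (h - g) (h - g) = 0"
    using assms(2) WH by (simp add: ip_linear mem_S)
  then show "h = g" using ip_definite WH by force
qed (use assms in auto)

context
  fixes W assumes W: "projectable W"
begin

lemma orth_proj_props:
  assumes "f \<in> H"
  shows "orth_proj ip W f \<in> W" "orth_proj ip W f \<in> H"
    and "w \<in> W \<Longrightarrow> ip (f - orth_proj ip W f) w = 0"
    and "w \<in> W \<Longrightarrow> ip (orth_proj ip W f) w = ip f w"
proof -
  have WH: "W \<subseteq> H" using W by (simp add: projectable_def)
  obtain g where g: "g \<in> W" "\<forall>w\<in>W. ip (f - g) w = 0"
    using W assms by (auto simp: projectable_def)
  then have eq: "orth_proj ip W f = g" using orth_proj_eqI[OF W assms] by blast
  show "orth_proj ip W f \<in> W" "orth_proj ip W f \<in> H" using eq g WH by auto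
  show *: "ip (f - orth_proj ip W f) w = 0" if "w \<in> W" for w using that eq g by simp
  show "ip (orth_proj ip W f) w = ip f w" if "w \<in> W"
    using *[OF that] that assms WH eq g by (auto simp: ip_linear subset_iff)
qed

lemma orth_proj_id: "f \<in> W \<Longrightarrow> orth_proj ip W f = f"
  by (rule orth_proj_eqI[OF W]) (use W in \<open>auto simp: projectable_def subset_iff\<close>)

lemma orth_proj_diff:
  assumes "f \<in> H" "g \<in> H"
  shows "orth_proj ip W (f - g) = orth_proj ip W f - orth_proj ip W g"
proof (rule orth_proj_eqI[OF W])
  fix w assume w: "w \<in> W"
  then have "w \<in> H" using W by (auto simp: projectable_def)
  then show "ip (f - g - (orth_proj ip W f - orth_proj ip W g)) w = 0"
    using assms orth_proj_props w by (simp add: ip_linear mem_S)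
qed (use assms orth_proj_props mem_S W in \<open>auto simp: projectable_def subspace_diff\<close>)

lemma orth_proj_Pythagoras:
  assumes "f \<in> H"
  shows "ip (f - orth_proj ip W f) (f - orth_proj ip W f) =
    ip f f - ip (orth_proj ip W f) (orth_proj ip W f)"
  using orth_proj_props(1,2)[OF assms] orth_proj_props(4)[OF assms orth_proj_props(1)[OF assms]] assms
  by (simp add: ip_linear mem_S ip_comm[of f "orth_proj ip W f"])

lemma nrm_orth_proj_le:
  assumes "f \<in> H"
  shows "nrm (orth_proj ip W f) \<le> nrm f" "nrm (f - orth_proj ip W f) \<le> nrm f"
proof -
  have "0 \<le> ip (f - orth_proj ip W f) (f - orth_proj ip W f)"
    "0 \<le> ip (orth_proj ip W f) (orth_proj ip W f)"
    using assms by (auto intro!: ip_nonneg mem_S orth_proj_props(2))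
  then show "nrm (orth_proj ip W f) \<le> nrm f" "nrm (f - orth_proj ip W f) \<le> nrm f"
    using orth_proj_Pythagoras[OF assms] by (auto simp: ip_norm_def)
qed

end

lemma orth_proj_span:
  assumes "ortho B" "finite B" "f \<in> H"
  shows "orth_proj ip (span B) f = proj_sum B f"
  by (rule orth_proj_eqI[OF span_ortho_projectable])
    (use assms proj_sum_in_span proj_sum_orthogonal in auto)

section \<open>Complete orthonormal sequences\<close>

text \<open>The family is indexed by all natural numbers and is zero off \<open>I\<close>, so that finite and infinite systems are
  treated by the same series.  The partial sums are Cauchy since the squared coefficients are summable, and
  the limit differs from \<open>f\<close> by a vector orthogonal to the whole family, that is, by zero.\<close>

theorem complete_orthonormal_expansion:
  fixes e :: "nat \<Rightarrow> 'v"
  assumes e: "\<And>j. e j \<in> H"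
    and on: "\<And>i j. ip (e i) (e j) = (if i = j \<and> i \<in> I then 1 else 0)"
    and cpl: "\<And>f. f \<in> H \<Longrightarrow> (\<And>j. ip f (e j) = 0) \<Longrightarrow> f = 0"
    and f: "f \<in> H"
  shows "(\<lambda>N. nrm ((\<Sum>j<N. ip f (e j) *\<^sub>R e j) - f)) \<longlonglongrightarrow> 0"
    and "(\<lambda>j. (ip f (e j))\<^sup>2) sums ip f f"
proof -
  define c where "c j = ip f (e j)" for j
  define S where "S N = (\<Sum>j<N. c j *\<^sub>R e j)" for N
  define T where "T N = (\<Sum>j<N. (c j)\<^sup>2)" for N :: nat
  have c0: "c j = 0" if "j \<notin> I" for j
  proof -
    have "e j = 0" using ip_definite[OF e, of j] on[of j j] that by simp
    then show ?thesis using f by (simp add: c_def)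
  qed
  have SH: "S N \<in> H" for N unfolding S_def using e by (intro mem_S) auto
  have Se: "ip (S N) (e j) = (if j < N then c j else 0)" for N j
  proof -
    have "ip (S N) (e j) = (\<Sum>i<N. c i * (if i = j \<and> i \<in> I then 1 else 0))"
      unfolding S_def using e by (subst ip_sum_left) (auto simp: ip_linear mem_S on)
    also have "\<dots> = (\<Sum>i<N. if i = j then c i else 0)"
      using c0 by (intro sum.cong) auto
    finally show ?thesis by simp
  qed
  have SS: "ip (S M) (S N) = T M" if "M \<le> N" for M N
  proof -
    have "ip (S M) (S N) = (\<Sum>j<M. c j * ip (S N) (e j))"
      unfolding S_def[of M] using e SH
      by (subst ip_sum_left) (auto simp: ip_linear mem_S ip_comm[of "e _" "S N"])
    also have "\<dots> = T M"
      unfolding T_def using that by (intro sum.cong) (auto simp: Se power2_eq_square)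
    finally show ?thesis .
  qed
  have fS: "ip f (S N) = T N" for N
    unfolding S_def T_def using e f
    by (subst ip_sum_right) (auto simp: ip_linear mem_S c_def power2_eq_square)
  have T_le: "T N \<le> ip f f" for N
  proof -
    have "0 \<le> ip (f - S N) (f - S N)" using f SH by (intro ip_nonneg mem_S)
    also have "\<dots> = ip f f - T N"
      using f SH by (simp add: ip_linear mem_S fS SS ip_comm[of "S N" f])
    finally show ?thesis by simp
  qed
  have "summable (\<lambda>j. (c j)\<^sup>2)"
    by (rule bounded_imp_summable[of _ "ip f f"]) (use T_le[of "Suc _"] in \<open>auto simp: T_def lessThan_Suc_atMost\<close>)
  then have T_sums: "T \<longlonglongrightarrow> (\<Sum>j. (c j)\<^sup>2)"
    unfolding T_def by (rule summable_LIMSEQ)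
  obtain l where l: "l \<in> H" "(\<lambda>N. nrm (S N - l)) \<longlonglongrightarrow> 0"
  proof (rule complete_closed_sq[OF closed_subspace_self SH])
    fix r :: real assume "r > 0"
    then obtain N where N: "\<And>i j. i \<ge> N \<Longrightarrow> j \<ge> N \<Longrightarrow> \<bar>T i - T j\<bar> < r"
      using LIMSEQ_imp_Cauchy[OF T_sums] unfolding Cauchy_def dist_real_def by metis
    have diff: "ip (S i - S j) (S i - S j) = \<bar>T i - T j\<bar>" for i j
    proof (cases "i \<le> j")
      case True
      have "T i \<le> T j" unfolding T_def using True by (intro sum_mono2) auto
      then show ?thesis
        using True SH SS[of i i] SS[of j j] SS[of i j]
        by (simp add: ip_linear mem_S ip_comm[of "S j" "S i"])
    next
      case False
      then have "T j \<le> T i" unfolding T_def by (intro sum_mono2) auto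
      then show ?thesis
        using False SH SS[of i i] SS[of j j] SS[of j i]
        by (simp add: ip_linear mem_S ip_comm[of "S i" "S j"])
    qed
    show "\<exists>N. \<forall>i\<ge>N. \<forall>j\<ge>N. ip (S i - S j) (S i - S j) < r"
      unfolding diff using N by blast
  qed (use that in blast)
  have "ip l (e j) = c j" for j
  proof (rule LIMSEQ_unique)
    show "(\<lambda>N. ip (S N) (e j)) \<longlonglongrightarrow> ip l (e j)" by (rule tendsto_ip[OF SH l(1) e l(2)])
    have "\<forall>\<^sub>F N in sequentially. c j = ip (S N) (e j)"
      using eventually_gt_at_top[of j] by eventually_elim (simp add: Se)
    then show "(\<lambda>N. ip (S N) (e j)) \<longlonglongrightarrow> c j"
      using Lim_transform_eventually tendsto_const by fast
  qed
  then have "f - l = 0"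
    using f l e by (intro cpl) (auto simp: mem_S ip_linear c_def)
  then have lim: "(\<lambda>N. nrm (S N - f)) \<longlonglongrightarrow> 0" using l by simp
  then show "(\<lambda>N. nrm ((\<Sum>j<N. ip f (e j) *\<^sub>R e j) - f)) \<longlonglongrightarrow> 0"
    by (simp add: S_def c_def)
  have "T \<longlonglongrightarrow> ip f f"
    using tendsto_ip_self[OF SH f lim] by (simp add: SS)
  then show "(\<lambda>j. (ip f (e j))\<^sup>2) sums ip f f"
    by (simp add: sums_def T_def[abs_def] c_def)
qed

end

section \<open>Compact forms\<close>

text \<open>The form \<open>q\<close> stands for the \<open>L\<^sub>2\<close> product on a native space.  Precompactness of the unit ball with
  respect to \<open>q\<close> expresses that the operator \<open>A\<close> given by \<open>ip (A f) g = q f g\<close> is compact.\<close>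

locale compact_form = hilbert H ip + q: ip_space H q
  for H :: "'v::real_vector set" and ip q +
  fixes C :: real
  assumes q_bound: "f \<in> H \<Longrightarrow> q f f \<le> C * ip f f"
    and q_compact: "(\<And>i. s i \<in> H \<and> ip (s i) (s i) \<le> 1) \<Longrightarrow>
      \<exists>r. strict_mono (r :: nat \<Rightarrow> nat) \<and>
        (\<forall>e>0. \<exists>N. \<forall>i\<ge>N. \<forall>j\<ge>N. q (s (r i) - s (r j)) (s (r i) - s (r j)) < e)"
begin

lemma q_nrm_bound: "f \<in> H \<Longrightarrow> q.nrm f \<le> sqrt C * nrm f"
  using real_sqrt_le_mono[OF q_bound] by (simp add: ip_norm_def real_sqrt_mult)

lemma q_nrm_tendsto:
  assumes "\<And>i. s i \<in> H" "l \<in> H" "(\<lambda>i. nrm (s i - l)) \<longlonglongrightarrow> 0"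
  shows "(\<lambda>i. q.nrm (s i - l)) \<longlonglongrightarrow> 0"
proof (rule Lim_null_comparison)
  show "\<forall>\<^sub>F i in sequentially. norm (q.nrm (s i - l)) \<le> sqrt C * nrm (s i - l)"
    using assms by (intro always_eventually allI) (simp add: q_nrm_bound mem_S)
  show "(\<lambda>i. sqrt C * nrm (s i - l)) \<longlonglongrightarrow> 0"
    using tendsto_mult_right_zero[OF assms(3)] by blast
qed

lemma q_representation:
  assumes "f \<in> H"
  obtains h where "h \<in> H" "\<And>g. g \<in> H \<Longrightarrow> ip h g = q f g"
proof (rule Riesz[OF closed_subspace_self, of "q f" "q.nrm f * sqrt C"])
  fix g assume g: "g \<in> H"
  have "\<bar>q f g\<bar> \<le> q.nrm f * q.nrm g" using assms g by (rule q.Cauchy_Schwarz)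
  also have "\<dots> \<le> q.nrm f * (sqrt C * nrm g)"
    using assms g by (intro mult_left_mono q_nrm_bound) auto
  finally show "\<bar>q f g\<bar> \<le> q.nrm f * sqrt C * nrm g" by (simp add: mult.assoc)
qed (use assms that in \<open>auto simp: q.ip_linear\<close>)

text \<open>With \<open>M\<close> the supremum of \<open>q\<close> on the unit sphere of \<open>W\<close>, the form \<open>Q = M * ip - q\<close> is nonnegative on \<open>W\<close> and
  tends to zero along a maximising sequence.  The parallelogram identity for \<open>Q\<close> upgrades convergence in
  \<open>q\<close>, which compactness provides, to convergence in norm; the limit is a zero of \<open>Q\<close>, and
  the first-order condition there is the eigenvector equation on \<open>W\<close>.\<close>

theorem maximizer_exists:
  assumes W: "closed_subspace H ip W" and nz: "\<exists>f\<in>W. f \<noteq> 0"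
  obtains M f where "M > 0" "f \<in> W" "f \<noteq> 0" "\<And>g. g \<in> W \<Longrightarrow> q f g = M * ip f g"
proof -
  have sW: "subspace W" and WH: "W \<subseteq> H" using W by (auto simp: closed_subspace_def)
  note memW = subspace_0[OF sW] subspace_add[OF sW] subspace_diff[OF sW] subspace_scale[OF sW]
  have inH: "f \<in> H" if "f \<in> W" for f using that WH by blast
  define Z where "Z = {q f f | f. f \<in> W \<and> ip f f = 1}"
  have normalize: "\<exists>g\<in>W. ip g g = 1 \<and> q f f = ip f f * q g g" if f: "f \<in> W" "f \<noteq> 0" for f
  proof -
    have n: "nrm f \<noteq> 0" using f inH nrm_zero_iff by blast
    let ?g = "(1 / nrm f) *\<^sub>R f"
    have "?g \<in> W" "ip ?g ?g = 1" "q f f = ip f f * q ?g ?g"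
      using f inH[OF f(1)] n
      by (simp_all add: memW ip_linear q.ip_linear mem_S nrm_sq[OF inH[OF f(1)], symmetric] power2_eq_square)
    then show ?thesis by blast
  qed
  have bdd: "bdd_above Z"
    unfolding Z_def using q_bound inH by (intro bdd_aboveI[of _ C]) force
  obtain f0 where f0: "f0 \<in> W" "ip f0 f0 = 1"
    using nz normalize by blast
  define M where "M = Sup Z"
  have M_ge: "q f f \<le> M" if "f \<in> W" "ip f f = 1" for f
    unfolding M_def using bdd that by (intro cSup_upper) (auto simp: Z_def)
  have "f0 \<noteq> 0" using f0 mem_S by force
  then have "q f0 f0 > 0" using q.ip_definite[of f0] q.ip_nonneg[of f0] f0 inH by force
  then have M_pos: "M > 0" using M_ge[OF f0] by linarith
  define Q where "Q f g = M * ip f g - q f g" for f g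
  have Q_nonneg: "0 \<le> Q f f" if f: "f \<in> W" for f
  proof (cases "f = 0")
    case True
    then show ?thesis using mem_S by (simp add: Q_def)
  next
    case False
    then obtain g where g: "g \<in> W" "ip g g = 1" "q f f = ip f f * q g g"
      using normalize f by blast
    then show ?thesis
      using M_ge[OF g(1,2)] ip_nonneg[of f] inH[OF f]
      by (simp add: Q_def mult.commute[of M] flip: right_diff_distrib)
  qed
  have "\<exists>f\<in>W. ip f f = 1 \<and> M - 1 / real (Suc i) < q f f" for i
  proof -
    have "M - 1 / real (Suc i) < Sup Z" unfolding M_def by simp
    then have "\<exists>z\<in>Z. M - 1 / real (Suc i) < z"
      using bdd f0 by (subst less_cSup_iff[symmetric]) (auto simp: Z_def)
    then show ?thesis by (auto simp: Z_def)
  qed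
  then obtain s where s: "\<And>i. s i \<in> W" "\<And>i. ip (s i) (s i) = 1"
      "\<And>i. M - 1 / real (Suc i) < q (s i) (s i)" by metis
  obtain r where r: "strict_mono (r :: nat \<Rightarrow> nat)"
      "\<And>e. e > 0 \<Longrightarrow> \<exists>N. \<forall>i\<ge>N. \<forall>j\<ge>N. q (s (r i) - s (r j)) (s (r i) - s (r j)) < e"
    using q_compact[of s] s(1,2) inH by auto
  define t where "t i = s (r i)" for i
  have t: "t i \<in> W" "ip (t i) (t i) = 1" for i using s by (auto simp: t_def)
  have tQ: "Q (t i) (t i) \<le> 1 / real (Suc i)" for i
  proof -
    have "1 / real (Suc (r i)) \<le> 1 / real (Suc i)"
      using seq_suble[OF r(1), of i] by (intro divide_left_mono) auto
    then show ?thesis using s(3)[of "r i"] t(2)[of i] by (simp add: Q_def t_def)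
  qed
  have para: "M * ip (f - g) (f - g) \<le> 2 * Q f f + 2 * Q g g + q (f - g) (f - g)"
    if "f \<in> W" "g \<in> W" for f g
  proof -
    have "2 * Q f f + 2 * Q g g + q (f - g) (f - g) - M * ip (f - g) (f - g) = Q (f + g) (f + g)"
      using that inH
      by (simp add: Q_def ip_linear q.ip_linear mem_S ip_comm[of g f] q.ip_comm[of g f] algebra_simps)
    then show ?thesis using Q_nonneg[of "f + g"] memW that by simp
  qed
  obtain l where l: "l \<in> W" "(\<lambda>i. nrm (t i - l)) \<longlonglongrightarrow> 0"
  proof (rule complete_closed_sq[OF W t(1)])
    fix e :: real assume e: "e > 0"
    then obtain N1 where N1: "\<And>i j. i \<ge> N1 \<Longrightarrow> j \<ge> N1 \<Longrightarrow> q (t i - t j) (t i - t j) < M * e / 2"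
      using r(2)[of "M * e / 2"] M_pos by (auto simp: t_def)
    obtain N2 where N2: "1 / real (Suc N2) < M * e / 8"
      using reals_Archimedean[of "M * e / 8"] e M_pos by (auto simp: inverse_eq_divide)
    have "ip (t i - t j) (t i - t j) < e" if "i \<ge> max N1 N2" "j \<ge> max N1 N2" for i j
    proof -
      have "1 / real (Suc i) \<le> 1 / real (Suc N2)" "1 / real (Suc j) \<le> 1 / real (Suc N2)"
        using that by (auto intro!: divide_left_mono)
      then have "M * ip (t i - t j) (t i - t j) < M * e"
        using para[OF t(1)[of i] t(1)[of j]] tQ[of i] tQ[of j] N1[of i j] N2 that by simp
      then show ?thesis using M_pos by simp
    qed
    then show "\<exists>N. \<forall>i\<ge>N. \<forall>j\<ge>N. ip (t i - t j) (t i - t j) < e" by blast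
  qed (use that in blast)
  have tH: "\<And>i. t i \<in> H" and lH: "l \<in> H" using t l inH by auto
  have "(\<lambda>i. Q (t i) (t i)) \<longlonglongrightarrow> Q l l"
    unfolding Q_def using tH lH l(2)
    by (intro tendsto_intros tendsto_ip_self q.tendsto_ip_self q_nrm_tendsto) auto
  then have "Q l l \<le> 0"
    by (rule LIMSEQ_le[OF _ LIMSEQ_Suc[OF lim_1_over_n]]) (use tQ in auto)
  then have Ql: "Q l l = 0" using Q_nonneg[OF l(1)] by simp
  have "ip l l = 1"
    using LIMSEQ_unique[OF tendsto_ip_self[OF tH lH l(2)]] t(2) by simp
  then have "l \<noteq> 0" using mem_S by force
  moreover have "q l g = M * ip l g" if g: "g \<in> W" for g
  proof -
    have "0 \<le> Q g g * t\<^sup>2 + 2 * Q l g * t" for t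
    proof -
      have "0 \<le> Q (l + t *\<^sub>R g) (l + t *\<^sub>R g)" using l g memW by (intro Q_nonneg) auto
      also have "\<dots> = Q l l + (Q g g * t\<^sup>2 + 2 * Q l g * t)"
        using lH inH[OF g]
        by (simp add: Q_def ip_linear q.ip_linear mem_S ip_comm[of g l] q.ip_comm[of g l]
            power2_eq_square algebra_simps)
      finally show ?thesis using Ql by simp
    qed
    then have "Q l g = 0"
      using Q_nonneg[OF g] by (intro quadratic_nonneg_imp_linear_zero[of "Q g g"]) auto
    then show ?thesis by (simp add: Q_def)
  qed
  ultimately show ?thesis using that M_pos l by blast
qed

definition form_eigenspace :: "real \<Rightarrow> 'v set" where
  "form_eigenspace \<mu> = {f \<in> H. \<forall>g\<in>H. q f g = \<mu> * ip f g}"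

lemma subspace_form_eigenspace: "subspace (form_eigenspace \<mu>)"
  by (auto simp: subspace_def form_eigenspace_def mem_S ip_linear q.ip_linear algebra_simps)

lemma form_eigenspace_subset: "form_eigenspace \<mu> \<subseteq> H"
  by (auto simp: form_eigenspace_def)

lemma form_eigenspace_orthogonal:
  assumes "f \<in> form_eigenspace \<mu>" "g \<in> form_eigenspace \<nu>" "\<mu> \<noteq> \<nu>"
  shows "ip f g = 0" "q f g = 0"
proof -
  have fg: "f \<in> H" "g \<in> H" using assms by (auto simp: form_eigenspace_def)
  have "q f g = \<mu> * ip f g" "q g f = \<nu> * ip g f" using assms fg by (auto simp: form_eigenspace_def)
  then have "(\<mu> - \<nu>) * ip f g = 0"
    using ip_comm[OF fg] q.ip_comm[OF fg] by (auto simp: algebra_simps)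
  then show "ip f g = 0" "q f g = 0" using assms(3) \<open>q f g = \<mu> * ip f g\<close> by auto
qed

end

text \<open>The condition on multiplicities makes \<open>lam\<close> a full list: a family of independent eigenvectors with these eigenvalues
  exhausts every eigenspace.\<close>

locale eigen_enum = compact_form H ip q C
  for H :: "'v::real_vector set" and ip q C +
  fixes I :: "nat set" and lam :: "nat \<Rightarrow> real"
  assumes lam_pos: "j \<in> I \<Longrightarrow> 0 < lam j"
    and lam_antimono: "i \<in> I \<Longrightarrow> j \<in> I \<Longrightarrow> i \<le> j \<Longrightarrow> lam j \<le> lam i"
    and finite_mult: "\<mu> > 0 \<Longrightarrow> finite {j \<in> I. lam j = \<mu>}"
    and mult: "\<mu> > 0 \<Longrightarrow> \<exists>F. finite F \<and> independent F \<and> span F = form_eigenspace \<mu> \<and> card F = card {j \<in> I. lam j = \<mu>}"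
begin

definition eigenfamily :: "(nat \<Rightarrow> 'v) \<Rightarrow> bool" where
  "eigenfamily \<phi> \<longleftrightarrow> (\<forall>j\<in>I. \<phi> j \<in> form_eigenspace (lam j)) \<and>
     (\<forall>i\<in>I. \<forall>j\<in>I. q (\<phi> i) (\<phi> j) = (if i = j then 1 else 0))"

lemma q_ortho_form_eigenspace_basis:
  assumes "\<mu> > 0" "q.ortho B" "B \<subseteq> form_eigenspace \<mu>"
  obtains D where "q.ortho D" "B \<subseteq> D" "finite D" "span D = form_eigenspace \<mu>" "card D = card {j \<in> I. lam j = \<mu>}"
proof -
  obtain F where F: "finite F" "independent F" "span F = form_eigenspace \<mu>" "card F = card {j \<in> I. lam j = \<mu>}"
    using mult[OF assms(1)] by blast
  have "dim (form_eigenspace \<mu>) = card F" using F dim_eq_card[of F "form_eigenspace \<mu>"] by (metis span_span)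
  then show ?thesis
    using q.ortho_extend[OF subspace_form_eigenspace form_eigenspace_subset F(1) _ assms(2,3)] F that by (metis order_refl)
qed

text \<open>Distinct eigenspaces are orthogonal for both products, so orthonormal bases of the single
  eigenspaces can be chosen independently.\<close>

theorem eigenfamily_exists: "\<exists>\<phi>. eigenfamily \<phi>"
proof -
  define J where "J \<mu> = {j \<in> I. lam j = \<mu>}" for \<mu>
  have "\<exists>g. inj_on g (J \<mu>) \<and> g ` J \<mu> \<subseteq> form_eigenspace \<mu> \<and> q.ortho (g ` J \<mu>)" if mu: "\<mu> > 0" for \<mu>
  proof -
    obtain D where D: "q.ortho D" "finite D" "span D = form_eigenspace \<mu>" "card D = card (J \<mu>)"
      using q_ortho_form_eigenspace_basis[OF mu, of "{}"] by (auto simp: q.ortho_def J_def)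
    have "finite (J \<mu>)" using finite_mult[OF mu] by (simp add: J_def)
    then obtain g where "bij_betw g (J \<mu>) D"
      using finite_same_card_bij D by metis
    then show ?thesis using D span_superset[of D] by (auto simp: bij_betw_def)
  qed
  then obtain g where g: "\<And>\<mu>. \<mu> > 0 \<Longrightarrow> inj_on (g \<mu>) (J \<mu>)"
      "\<And>\<mu>. \<mu> > 0 \<Longrightarrow> g \<mu> ` J \<mu> \<subseteq> form_eigenspace \<mu>" "\<And>\<mu>. \<mu> > 0 \<Longrightarrow> q.ortho (g \<mu> ` J \<mu>)"
    by metis
  define \<phi> where "\<phi> j = g (lam j) j" for j
  have mem: "\<phi> j \<in> form_eigenspace (lam j)" if "j \<in> I" for j
    using g(2)[OF lam_pos[OF that]] that by (auto simp: \<phi>_def J_def)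
  have "q (\<phi> i) (\<phi> j) = (if i = j then 1 else 0)" if ij: "i \<in> I" "j \<in> I" for i j
  proof (cases "lam i = lam j")
    case True
    have "i \<in> J (lam i)" "j \<in> J (lam i)" using True ij by (auto simp: J_def)
    then show ?thesis
      using g(1,3)[OF lam_pos[OF ij(1)]] True by (auto simp: \<phi>_def q.ortho_def inj_on_eq_iff)
  next
    case False
    then show ?thesis using form_eigenspace_orthogonal(2)[OF mem[OF ij(1)] mem[OF ij(2)]] by auto
  qed
  then have "eigenfamily \<phi>" using mem unfolding eigenfamily_def by blast
  then show ?thesis by blast
qed

context
  fixes \<phi> assumes \<phi>: "eigenfamily \<phi>"
begin

lemma eigenfamily_props:
  shows eigenfamily_mem: "j \<in> I \<Longrightarrow> \<phi> j \<in> H"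
    and eigenfamily_form_eigenspace: "j \<in> I \<Longrightarrow> \<phi> j \<in> form_eigenspace (lam j)"
    and eigenfamily_q: "i \<in> I \<Longrightarrow> j \<in> I \<Longrightarrow> q (\<phi> i) (\<phi> j) = (if i = j then 1 else 0)"
    and eigenfamily_eq: "j \<in> I \<Longrightarrow> g \<in> H \<Longrightarrow> q (\<phi> j) g = lam j * ip (\<phi> j) g"
  using \<phi> unfolding eigenfamily_def form_eigenspace_def by blast+

lemma inj_eigenfamily: "inj_on \<phi> I"
  by (rule inj_onI) (metis eigenfamily_q zero_neq_one)

lemma q_ortho_eigenfamily: "J \<subseteq> I \<Longrightarrow> q.ortho (\<phi> ` J)"
  using inj_eigenfamily unfolding q.ortho_def
  by (auto simp: eigenfamily_mem eigenfamily_q subset_iff inj_on_eq_iff)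

text \<open>The family supplies as many independent vectors in the eigenspace as its dimension.\<close>

lemma form_eigenspace_eq_span:
  assumes mu: "\<mu> > 0"
  shows "form_eigenspace \<mu> = span (\<phi> ` {j \<in> I. lam j = \<mu>})" (is "_ = span (\<phi> ` ?J)")
proof
  have sub: "\<phi> ` ?J \<subseteq> form_eigenspace \<mu>" using eigenfamily_form_eigenspace by auto
  show "span (\<phi> ` ?J) \<subseteq> form_eigenspace \<mu>" using sub subspace_form_eigenspace by (rule span_minimal)
  have inj: "inj_on \<phi> ?J" using inj_eigenfamily by (rule inj_on_subset) auto
  have ort: "q.ortho (\<phi> ` ?J)" by (rule q_ortho_eigenfamily) auto
  obtain D where D: "q.ortho D" "\<phi> ` ?J \<subseteq> D" "finite D" "span D = form_eigenspace \<mu>" "card D = card ?J"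
    using q_ortho_form_eigenspace_basis[OF mu ort sub] .
  have "\<phi> ` ?J = D" using D inj by (intro card_subset_eq) (auto simp: card_image)
  then show "form_eigenspace \<mu> \<subseteq> span (\<phi> ` ?J)" using D by simp
qed

text \<open>Eigenvectors normalised for \<open>q\<close> have squared length \<open>1 / lam j\<close> for \<open>ip\<close>; the factor \<open>sqrt (lam j)\<close> makes them
  orthonormal for \<open>ip\<close>.\<close>

definition native_basis :: "nat \<Rightarrow> 'v" where
  "native_basis j = (if j \<in> I then sqrt (lam j) *\<^sub>R \<phi> j else 0)"

lemma native_basis_mem [simp]: "native_basis j \<in> H"
  by (auto simp: native_basis_def mem_S eigenfamily_mem)

lemma native_basis_orthonormal:
  "ip (native_basis i) (native_basis j) = (if i = j \<and> i \<in> I then 1 else 0)"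
proof (cases "i \<in> I \<and> j \<in> I")
  case True
  then have "lam i * ip (\<phi> i) (\<phi> j) = (if i = j then 1 else 0)"
    using eigenfamily_eq[of i "\<phi> j"] eigenfamily_q[of i j] by (simp add: eigenfamily_mem)
  moreover have sq: "sqrt (lam j) * (sqrt (lam j) * x) = lam j * x" for x
    using True lam_pos[of j] by (simp add: mult.assoc[symmetric])
  ultimately show ?thesis
    using True lam_pos[of i]
    by (cases "i = j") (auto simp: sq native_basis_def ip_linear mem_S eigenfamily_mem)
next
  case False
  then show ?thesis by (auto simp: native_basis_def mem_S eigenfamily_mem)
qed

lemma q_native_basis: "f \<in> H \<Longrightarrow> q f (native_basis j) = lam j * ip f (native_basis j)"
  using eigenfamily_eq[of j f] eigenfamily_mem[of j]
  by (auto simp: native_basis_def q.ip_linear ip_linear mem_S ip_comm[of f] q.ip_comm[of f])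

lemma inj_native_basis: "inj_on native_basis I"
  by (rule inj_onI) (metis native_basis_orthonormal zero_neq_one)

lemma ortho_native_basis: "J \<subseteq> I \<Longrightarrow> ortho (native_basis ` J)"
  using inj_native_basis unfolding ortho_def
  by (auto simp: native_basis_orthonormal subset_iff inj_on_eq_iff)

text \<open>On the orthogonal complement \<open>W\<close> of the system a maximiser satisfies the eigenvector equation tested
  against \<open>W\<close>.  Since \<open>W\<close> is invariant it is an eigenvector of the whole space, and then it lies in the span
  of the family, to which it is orthogonal.\<close>

theorem native_basis_complete:
  assumes f: "f \<in> H" "\<And>j. ip f (native_basis j) = 0"
  shows "f = 0"
proof (rule ccontr)
  assume "f \<noteq> 0"
  define W where "W = {g \<in> H. \<forall>j. ip g (native_basis j) = 0}"
  have WH: "W \<subseteq> H" by (auto simp: W_def)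
  have W: "closed_subspace H ip W"
    unfolding closed_subspace_def
  proof (intro conjI allI impI)
    show "subspace W" by (auto simp: subspace_def W_def mem_S ip_linear)
    fix s :: "nat \<Rightarrow> 'v" and l
    assume s: "(\<forall>i. s i \<in> W) \<and> l \<in> H \<and> (\<lambda>i. nrm (s i - l)) \<longlonglongrightarrow> 0"
    have "ip l (native_basis j) = 0" for j
    proof (rule LIMSEQ_unique)
      show "(\<lambda>i. ip (s i) (native_basis j)) \<longlonglongrightarrow> ip l (native_basis j)"
        using s WH by (intro tendsto_ip) auto
      show "(\<lambda>i. ip (s i) (native_basis j)) \<longlonglongrightarrow> 0" using s by (simp add: W_def)
    qed
    then show "l \<in> W" using s by (simp add: W_def)
  qed (rule WH)
  have "\<exists>f\<in>W. f \<noteq> 0" using f \<open>f \<noteq> 0\<close> by (auto simp: W_def)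
  then obtain M g where g: "M > 0" "g \<in> W" "g \<noteq> 0" "\<And>h. h \<in> W \<Longrightarrow> q g h = M * ip g h"
    using maximizer_exists[OF W] by blast
  have gH: "g \<in> H" using g WH by blast
  obtain h where h: "h \<in> H" "\<And>k. k \<in> H \<Longrightarrow> ip h k = q g k"
    using q_representation[OF gH] by blast
  have "h \<in> W" using h g(2) by (simp add: W_def q_native_basis)
  then have d: "h - M *\<^sub>R g \<in> W" using g(2) h gH by (simp add: W_def ip_linear mem_S)
  then have "ip (h - M *\<^sub>R g) (h - M *\<^sub>R g) = 0"
    using subsetD[OF WH d] h gH g(4)[OF d] by (simp add: ip_diff_left[of h] ip_scale_left[of g] mem_S)
  then have "h - M *\<^sub>R g = 0" using ip_definite d WH by blast
  then have "q g k = M * ip g k" if "k \<in> H" for k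
    using h(2)[OF that] that gH by (simp add: ip_linear)
  then have "g \<in> form_eigenspace M" using gH by (simp add: form_eigenspace_def)
  then have gs: "g \<in> span (\<phi> ` {j \<in> I. lam j = M})" using form_eigenspace_eq_span[OF g(1)] by simp
  have "ip g g = ip 0 g"
  proof (rule ip_span_eqI[OF _ gH mem_S(1) _ gs])
    fix b assume "b \<in> \<phi> ` {j \<in> I. lam j = M}"
    then obtain j where j: "j \<in> I" "b = \<phi> j" by blast
    have "ip g (native_basis j) = 0" using g(2) by (simp add: W_def)
    then have "sqrt (lam j) * ip g (\<phi> j) = 0"
      using j gH eigenfamily_mem[of j] by (simp add: native_basis_def ip_linear)
    then show "ip g b = ip 0 b" using j lam_pos[of j] eigenfamily_mem[of j] by simp
  qed (auto simp: eigenfamily_mem)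
  then show False using ip_definite[OF gH] gH g(3) by simp
qed

lemmas native_basis_expansion =
  complete_orthonormal_expansion[of native_basis I, OF native_basis_mem native_basis_orthonormal
    native_basis_complete, simplified]

text \<open>Convergence in norm implies convergence in \<open>q\<close>, and \<open>q\<close> is diagonal in the orthonormal system.\<close>

lemma q_expansion:
  assumes f: "f \<in> H"
  shows "(\<lambda>j. lam j * (ip f (native_basis j))\<^sup>2) sums q f f"
proof -
  define S where "S N = (\<Sum>j<N. ip f (native_basis j) *\<^sub>R native_basis j)" for N :: nat
  have SH: "S N \<in> H" for N unfolding S_def by (intro mem_S) auto
  have lim: "(\<lambda>N. nrm (S N - f)) \<longlonglongrightarrow> 0"
    using native_basis_expansion(1)[OF f] by (simp add: S_def)
  have "(\<lambda>N. q (S N) f) \<longlonglongrightarrow> q f f"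
    by (rule q.tendsto_ip[OF SH f f q_nrm_tendsto[OF SH f lim]])
  moreover have "q (S N) f = (\<Sum>j<N. lam j * (ip f (native_basis j))\<^sup>2)" for N
    unfolding S_def using f
    by (subst q.ip_sum_left)
      (auto simp: q.ip_linear mem_S q.ip_comm[of _ f] q_native_basis power2_eq_square
        intro!: sum.cong)
  ultimately show ?thesis by (simp add: sums_def)
qed

section \<open>The Ky Fan inequality\<close>

context
  fixes n U
  assumes n: "1 \<le> n" "{1..n} \<subseteq> I" "I \<subseteq> {1..}"
    and U: "ortho U" "finite U" "card U = n"
begin

text \<open>The squared length of the projection of the basis vector onto \<open>span U\<close>; hence the bounds \<open>0\<close> and \<open>1\<close>.\<close>

definition weight :: "nat \<Rightarrow> real" where
  "weight j = (\<Sum>u\<in>U. (ip u (native_basis j))\<^sup>2)"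

lemma U_subset: "u \<in> U \<Longrightarrow> u \<in> H" "u \<in> U \<Longrightarrow> ip u u = 1"
  using U(1) by (auto simp: ortho_def)

lemma weight_bounds:
  shows "0 \<le> weight j" and "j \<in> I \<Longrightarrow> weight j \<le> 1" and "j \<notin> I \<Longrightarrow> weight j = 0"
proof -
  show "0 \<le> weight j" by (simp add: weight_def sum_nonneg)
  have w: "weight j = (\<Sum>u\<in>U. (ip (native_basis j) u)\<^sup>2)"
    unfolding weight_def using U_subset by (intro sum.cong) (auto simp: ip_comm)
  show "weight j \<le> 1" if "j \<in> I"
    using Bessel[OF U(1,2), of "native_basis j"] that by (simp add: w native_basis_orthonormal)
  show "weight j = 0" if "j \<notin> I"
    using that U_subset by (simp add: weight_def native_basis_def)
qed

lemma weight_sums: "weight sums real n"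
proof -
  have "weight sums (\<Sum>u\<in>U. ip u u)"
    unfolding weight_def[abs_def] using U_subset by (intro sums_sum native_basis_expansion(2)) auto
  then show ?thesis using U_subset U(3) by simp
qed

lemma lam_weight_sums: "(\<lambda>j. lam j * weight j) sums (\<Sum>u\<in>U. q u u)"
proof -
  have "(\<lambda>j. \<Sum>u\<in>U. lam j * (ip u (native_basis j))\<^sup>2) sums (\<Sum>u\<in>U. q u u)"
    using U_subset by (intro sums_sum q_expansion) auto
  then show ?thesis by (simp add: weight_def sum_distrib_left)
qed

text \<open>The terms of \<open>(\<Sum>j=1..n. lam j) - \<Sum>j. lam j * weight j\<close>, with \<open>lam n\<close> subtracted from all eigenvalues.  As the weights
  add up to \<open>n\<close> this leaves the total unchanged, and it makes every single term nonnegative.\<close>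

definition gap :: "nat \<Rightarrow> real" where
  "gap j = (if j \<in> {1..n} then lam j - lam n else 0) - (lam j - lam n) * weight j"

lemma gap_nonneg: "0 \<le> gap j"
proof -
  have nI: "n \<in> I" using n by auto
  consider "j \<in> {1..n}" | "j \<in> I" "j > n" | "j \<notin> I" using n by fastforce
  then show ?thesis
  proof cases
    case 1
    then have "j \<in> I" using n(2) by blast
    then have "lam n \<le> lam j" using 1 nI lam_antimono[of j n] by simp
    then have "0 \<le> (lam j - lam n) * (1 - weight j)" using weight_bounds(2) \<open>j \<in> I\<close> by simp
    then show ?thesis using 1 by (simp add: gap_def algebra_simps)
  next
    case 2
    then have "lam j \<le> lam n" using nI lam_antimono[of n j] by simp
    then show ?thesis using 2 weight_bounds(1)[of j] by (simp add: gap_def mult_nonpos_nonneg)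
  next
    case 3
    then show ?thesis using n weight_bounds(3)[of j] by (auto simp: gap_def)
  qed
qed

lemma gap_sums: "gap sums ((\<Sum>j=1..n. lam j) - (\<Sum>u\<in>U. q u u))"
proof -
  have "(\<lambda>j. if j \<in> {1..n} then lam j - lam n else 0) sums (\<Sum>j=1..n. lam j - lam n)"
    by (rule sums_If_finite_set) simp
  then have "(\<lambda>j. (if j \<in> {1..n} then lam j - lam n else 0) - (lam j * weight j - lam n * weight j)) sums
    ((\<Sum>j=1..n. lam j - lam n) - ((\<Sum>u\<in>U. q u u) - lam n * real n))"
    by (intro sums_diff lam_weight_sums sums_mult weight_sums)
  then show ?thesis by (simp add: gap_def[abs_def] left_diff_distrib sum_subtractf mult.commute)
qed

theorem Ky_Fan: "(\<Sum>u\<in>U. q u u) \<le> (\<Sum>j=1..n. lam j)"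
  using sums_le[OF _ sums_zero gap_sums] gap_nonneg by simp

text \<open>If the gap vanishes, all its terms do.  For eigenvalues above \<open>lam n\<close> this means weight one, so these
  eigenvectors lie in \<open>span U\<close>; for eigenvalues below it means weight zero, so \<open>span U\<close> is orthogonal to them.
  A basis of \<open>span U\<close>, orthonormal for \<open>q\<close>, that extends the former is therefore completed by eigenvectors for
  \<open>lam n\<close> alone; enlarging these to a basis of that eigenspace gives \<open>\<psi>\<close>.\<close>

theorem Ky_Fan_equality:
  assumes eq: "(\<Sum>u\<in>U. q u u) = (\<Sum>j=1..n. lam j)"
  obtains \<psi> where "eigenfamily \<psi>" "span U = span (\<psi> ` {1..n})"
proof -
  have nI: "n \<in> I" using n by auto
  define \<mu> where "\<mu> = lam n"
  have mu: "\<mu> > 0" using lam_pos nI by (simp add: \<mu>_def)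
  have gap0: "gap j = 0" for j
  proof -
    have "gap sums 0" using gap_sums eq by simp
    then show ?thesis
      using suminf_eq_zero_iff[of gap] gap_nonneg by (auto simp: sums_iff)
  qed
  have inW: "native_basis j \<in> span U" if "j \<in> I" "lam j > \<mu>" for j
  proof (rule in_span_if_Bessel_eq[OF U(1,2) native_basis_mem])
    have "j \<in> {1..n}" using that lam_antimono[of n j] nI n by (force simp: \<mu>_def)
    then have "weight j = 1" using gap0[of j] that by (simp add: gap_def \<mu>_def)
    moreover have "weight j = (\<Sum>u\<in>U. (ip (native_basis j) u)\<^sup>2)"
      unfolding weight_def using U_subset by (intro sum.cong) (auto simp: ip_comm)
    ultimately show "(\<Sum>u\<in>U. (ip (native_basis j) u)\<^sup>2) = ip (native_basis j) (native_basis j)"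
      using that by (simp add: native_basis_orthonormal)
  qed
  have orthW: "ip (native_basis j) f = 0" if "j \<in> I" "lam j < \<mu>" "f \<in> span U" for j f
  proof -
    have "j > n" using that lam_antimono[of j n] nI by (force simp: \<mu>_def)
    then have "weight j = 0" using gap0[of j] that by (simp add: gap_def \<mu>_def)
    then have *: "ip u (native_basis j) = 0" if "u \<in> U" for u
      using that U(2) by (simp add: weight_def sum_nonneg_eq_0_iff)
    have "ip (native_basis j) f = ip 0 f"
    proof (rule ip_span_eqI[OF _ native_basis_mem mem_S(1) _ that(3)])
      fix u assume u: "u \<in> U"
      then show "ip (native_basis j) u = ip 0 u"
        using * ip_comm[OF native_basis_mem U_subset(1)[OF u]] U_subset(1) by simp
    qed (use U_subset in blast)
    then show ?thesis using that span_ortho_subset[OF U(1)] by auto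
  qed
  have \<phi>_nb: "\<phi> j = (1 / sqrt (lam j)) *\<^sub>R native_basis j" if "j \<in> I" for j
    using that lam_pos[OF that] by (simp add: native_basis_def)
  \<comment> \<open>\<open>{1..n}\<close> consists of \<open>P\<close>, the indices of larger eigenvalues, and of the first indices of the block \<open>J\<close> of \<open>lam n\<close>\<close>
  define J where "J = {j \<in> I. lam j = \<mu>}"
  define P where "P = {j \<in> I. lam j > \<mu>}"
  define J1 where "J1 = {j \<in> J. j \<le> n}"
  have split_n: "{1..n} = P \<union> J1" "P \<inter> J1 = {}"
  proof -
    show "P \<inter> J1 = {}" by (auto simp: P_def J1_def J_def)
    have "j \<le> n" if "j \<in> P" for j
      using that lam_antimono[of n j] nI by (force simp: \<mu>_def P_def)
    moreover have "\<mu> \<le> lam j" if "j \<in> {1..n}" for j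
      using that lam_antimono[of j n] nI n by (auto simp: \<mu>_def)
    ultimately show "{1..n} = P \<union> J1"
      using n by (fastforce simp: P_def J1_def J_def)
  qed
  then have finP: "finite P" "finite J1" by (metis finite_Un finite_atLeastAtMost)+
  have PI: "P \<subseteq> I" by (auto simp: P_def)
  define B0 where "B0 = \<phi> ` P"
  have B0: "q.ortho B0" "card B0 = card P" "finite B0"
    using q_ortho_eigenfamily[OF PI] inj_on_subset[OF inj_eigenfamily PI] finP
    by (auto simp: B0_def card_image)
  have "B0 \<subseteq> span U"
    unfolding B0_def using \<phi>_nb inW PI by (auto simp: P_def intro!: span_scale)
  then obtain B1 where B1: "q.ortho B1" "B0 \<subseteq> B1" "finite B1" "span B1 = span U"
      "card B1 = dim (span U)"
    using q.ortho_extend[OF subspace_span span_ortho_subset[OF U(1)] U(2) order_refl B0(1)] by blast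
  have cardB1: "card B1 = n"
    using B1(5) U(3) dim_eq_card_independent[OF ortho_independent[OF U(1)]] by simp
  define R where "R = B1 - B0"
  have R_W: "f \<in> span U" if "f \<in> R" for f using that B1(4) span_base by (auto simp: R_def)
  have R_eig: "R \<subseteq> form_eigenspace \<mu>"
  proof
    fix f assume f: "f \<in> R"
    have fH: "f \<in> H" using R_W[OF f] span_ortho_subset[OF U(1)] by blast
    have f0: "ip f (native_basis j) = 0" if "j \<notin> J" for j
    proof -
      consider "j \<notin> I" | "j \<in> I" "lam j < \<mu>" | "j \<in> P"
        using \<open>j \<notin> J\<close> by (fastforce simp: J_def P_def)
      then show ?thesis
      proof cases
        case 1
        then show ?thesis using fH by (simp add: native_basis_def)
      next
        case 2
        then show ?thesis using orthW[OF 2 R_W[OF f]] fH ip_comm by simp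
      next
        case 3
        then have j: "j \<in> I" "lam j > 0" using lam_pos by (auto simp: P_def)
        have "\<phi> j \<in> B1" "\<phi> j \<noteq> f" "f \<in> B1" using 3 B1(2) f by (auto simp: B0_def R_def)
        then have "q (\<phi> j) f = 0" using B1(1) by (auto simp: q.ortho_def)
        then have "ip f (\<phi> j) = 0"
          using eigenfamily_eq[OF j(1) fH] j fH ip_comm eigenfamily_mem by simp
        then show ?thesis using j fH eigenfamily_mem by (simp add: native_basis_def ip_linear)
      qed
    qed
    define D where "D = native_basis ` J"
    have JI: "J \<subseteq> I" by (auto simp: J_def)
    have D: "ortho D" "finite D"
      using ortho_native_basis[OF JI] finite_mult[OF mu] by (simp_all add: D_def J_def)
    have nb_eig: "native_basis j \<in> form_eigenspace (lam j)" if "j \<in> I" for j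
      using that eigenfamily_form_eigenspace subspace_form_eigenspace by (simp add: native_basis_def subspace_scale)
    have "D \<subseteq> form_eigenspace \<mu>" using nb_eig by (auto simp: D_def J_def)
    then have "span D \<subseteq> form_eigenspace \<mu>" using subspace_form_eigenspace by (rule span_minimal)
    then have p: "proj_sum D f \<in> form_eigenspace \<mu>" "proj_sum D f \<in> H"
      using proj_sum_in_span form_eigenspace_subset by blast+
    have "f - proj_sum D f = 0"
    proof (rule native_basis_complete)
      show "f - proj_sum D f \<in> H" using fH p mem_S by simp
      fix j
      show "ip (f - proj_sum D f) (native_basis j) = 0"
      proof (cases "j \<in> J")
        case True
        then show ?thesis
          by (intro proj_sum_orthogonal[OF D fH] span_base) (simp add: D_def)
      next
        case False
        have "ip (proj_sum D f) (native_basis j) = 0"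
        proof (cases "j \<in> I")
          case True
          then show ?thesis
            using False by (intro form_eigenspace_orthogonal(1)[OF p(1) nb_eig]) (auto simp: J_def)
        qed (use p in \<open>simp add: native_basis_def\<close>)
        then show ?thesis using f0[OF False] fH p by (simp add: ip_linear)
      qed
    qed
    then show "f \<in> form_eigenspace \<mu>" using p by simp
  qed
  have R_ortho: "q.ortho R" using B1(1) by (auto simp: q.ortho_def R_def)
  obtain B2 where B2: "q.ortho B2" "R \<subseteq> B2" "finite B2" "span B2 = form_eigenspace \<mu>" "card B2 = card J"
    using q_ortho_form_eigenspace_basis[OF mu R_ortho R_eig] by (auto simp: J_def)
  have finJ: "finite J" using finite_mult[OF mu] by (simp add: J_def)
  have J1J: "J1 \<subseteq> J" by (auto simp: J1_def)
  have "card P + card J1 = n"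
    using split_n finP by (metis card_Un_disjoint card_atLeastAtMost diff_Suc_1)
  moreover have "card R = n - card P"
    using B1(2) B0 cardB1 by (simp add: R_def card_Diff_subset)
  ultimately have cR: "card J1 = card R" by simp
  have finR: "finite R" using B1 by (simp add: R_def)
  obtain \<sigma>1 where s1: "bij_betw \<sigma>1 J1 R"
    using finite_same_card_bij[OF finP(2) finR cR] by blast
  have "card (J - J1) = card (B2 - R)"
    using B2 cR finR finP J1J by (simp add: card_Diff_subset)
  then obtain \<sigma>2 where s2: "bij_betw \<sigma>2 (J - J1) (B2 - R)"
    using finite_same_card_bij[of "J - J1" "B2 - R"] finJ B2(3) by blast
  \<comment> \<open>only the block of \<open>lam n\<close> is rearranged: its first indices go to the new vectors inside \<open>span U\<close>\<close>
  define \<psi> where "\<psi> j = (if j \<in> J then if j \<in> J1 then \<sigma>1 j else \<sigma>2 j else \<phi> j)" for j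
  have bij: "bij_betw \<psi> J B2"
  proof -
    have "bij_betw \<psi> (J1 \<union> (J - J1)) (R \<union> (B2 - R))"
    proof (rule bij_betw_combine)
      show "bij_betw \<psi> J1 R"
        using s1 J1J by (subst bij_betw_cong[of _ _ \<sigma>1]) (auto simp: \<psi>_def)
      show "bij_betw \<psi> (J - J1) (B2 - R)"
        using s2 by (subst bij_betw_cong[of _ _ \<sigma>2]) (auto simp: \<psi>_def)
    qed auto
    then show ?thesis using J1J B2(2) by (simp add: Un_absorb1)
  qed
  have mem: "\<psi> j \<in> form_eigenspace (lam j)" if "j \<in> I" for j
  proof (cases "j \<in> J")
    case True
    then have "\<psi> j \<in> B2" using bij by (auto simp: bij_betw_def)
    then show ?thesis using True B2(4) span_base by (auto simp: J_def)
  qed (use that eigenfamily_form_eigenspace in \<open>simp add: \<psi>_def\<close>)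
  have "q (\<psi> i) (\<psi> j) = (if i = j then 1 else 0)" if ij: "i \<in> I" "j \<in> I" for i j
  proof (cases "lam i = lam j")
    case False
    then show ?thesis using form_eigenspace_orthogonal(2)[OF mem[OF ij(1)] mem[OF ij(2)]] by auto
  next
    case same: True
    show ?thesis
    proof (cases "i \<in> J")
      case True
      then have "j \<in> J" using same ij by (simp add: J_def)
      then show ?thesis
        using True bij B2(1) by (auto simp: q.ortho_def bij_betw_def inj_on_eq_iff)
    next
      case False
      then have "j \<notin> J" using same ij by (simp add: J_def)
      then show ?thesis using False eigenfamily_q ij by (simp add: \<psi>_def)
    qed
  qed
  then have "eigenfamily \<psi>" using mem by (auto simp: eigenfamily_def)
  moreover have "\<psi> ` {1..n} = B1"
  proof -
    have "\<psi> ` J1 = R" using s1 J1J by (auto simp: \<psi>_def bij_betw_def)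
    moreover have "\<psi> ` P = B0" unfolding B0_def by (intro image_cong) (auto simp: \<psi>_def P_def J_def)
    ultimately show ?thesis using split_n B1(2) by (auto simp: image_Un R_def)
  qed
  ultimately show ?thesis using that B1(4) by metis
qed

end

lemma q_native_basis_self: "j \<in> I \<Longrightarrow> q (native_basis j) (native_basis j) = lam j"
  by (simp add: q_native_basis native_basis_orthonormal)

lemma span_native_basis: "J \<subseteq> I \<Longrightarrow> span (native_basis ` J) = span (\<phi> ` J)"
proof (intro equalityI span_minimal subspace_span subsetI)
  fix f assume J: "J \<subseteq> I" and "f \<in> native_basis ` J"
  then obtain j where j: "j \<in> J" "j \<in> I" "f = native_basis j" by blast
  then show "f \<in> span (\<phi> ` J)" by (simp add: native_basis_def span_base span_scale)
next
  fix f assume J: "J \<subseteq> I" and "f \<in> \<phi> ` J"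
  then obtain j where j: "j \<in> J" "j \<in> I" "f = \<phi> j" by blast
  then have "f = (1 / sqrt (lam j)) *\<^sub>R native_basis j"
    using lam_pos[of j] by (simp add: native_basis_def)
  then show "f \<in> span (native_basis ` J)" using j by (simp add: span_base span_scale)
qed

end

end

section \<open>Reproducing kernel Hilbert spaces with continuous feature map\<close>

text \<open>Continuity is required of the feature map \<open>x \<mapsto> k\<^sub>x\<close> into the Hilbert space and not of the kernel: a projection is
  a contraction, so this form passes to the kernel of a closed subspace at once, and it
  yields the continuity and the equicontinuity of the functions in the space.\<close>

locale cont_rkhs =
  fixes \<Omega> :: "'a::euclidean_space set" and k :: "'a \<Rightarrow> 'a \<Rightarrow> real"
    and H :: "('a \<Rightarrow> real) set" and ip :: "('a \<Rightarrow> real) \<Rightarrow> ('a \<Rightarrow> real) \<Rightarrow> real"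
  assumes compact_dom: "compact \<Omega>" and full_support_dom: "full_support \<Omega>"
    and native: "native_space \<Omega> k H ip"
    and feature: "x \<in> \<Omega> \<Longrightarrow> e > 0 \<Longrightarrow> \<exists>d>0. \<forall>y\<in>\<Omega>. dist y x < d \<longrightarrow>
      ip_norm ip (zero_ext \<Omega> (\<lambda>t. k t y) - zero_ext \<Omega> (\<lambda>t. k t x)) < e"

sublocale cont_rkhs \<subseteq> hilbert H ip
  by unfold_locales (use native in \<open>auto simp: native_space_def\<close>)

context cont_rkhs
begin

definition feat :: "'a \<Rightarrow> 'a \<Rightarrow> real" where
  "feat x = zero_ext \<Omega> (\<lambda>t. k t x)"

lemma feat_mem [simp]: "x \<in> \<Omega> \<Longrightarrow> feat x \<in> H"
  using native by (simp add: native_space_def feat_def)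

lemma reproducing: "f \<in> H \<Longrightarrow> x \<in> \<Omega> \<Longrightarrow> ip f (feat x) = f x"
  using native by (simp add: native_space_def feat_def)

lemma zero_outside: "f \<in> H \<Longrightarrow> x \<notin> \<Omega> \<Longrightarrow> f x = 0"
  using native by (simp add: native_space_def)

lemma ip_feat: "x \<in> \<Omega> \<Longrightarrow> y \<in> \<Omega> \<Longrightarrow> ip (feat x) (feat y) = k y x"
  using reproducing[OF feat_mem, of x y] by (simp add: feat_def zero_ext_def)

lemma kernel_commute: "x \<in> \<Omega> \<Longrightarrow> y \<in> \<Omega> \<Longrightarrow> k x y = k y x"
  using ip_feat ip_comm feat_mem by metis

lemma eq_on_dom: "f \<in> H \<Longrightarrow> g \<in> H \<Longrightarrow> (\<And>x. x \<in> \<Omega> \<Longrightarrow> f x = g x) \<Longrightarrow> f = g"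
  using zero_outside by (metis ext)

lemma continuous_on_via_feat:
  assumes "\<And>x y. x \<in> \<Omega> \<Longrightarrow> y \<in> \<Omega> \<Longrightarrow> \<bar>F y - F x\<bar> \<le> B * nrm (feat y - feat x)"
  shows "continuous_on \<Omega> F"
  unfolding continuous_on_iff
proof (intro ballI allI impI)
  fix x and e :: real assume x: "x \<in> \<Omega>" and e: "e > 0"
  have "e / (\<bar>B\<bar> + 1) > 0" using e by simp
  from feature[OF x this] obtain d where d: "d > 0"
    "\<And>y. y \<in> \<Omega> \<Longrightarrow> dist y x < d \<Longrightarrow> nrm (feat y - feat x) < e / (\<bar>B\<bar> + 1)"
    unfolding feat_def by blast
  have "dist (F y) (F x) < e" if y: "y \<in> \<Omega>" "dist y x < d" for y
  proof -
    have nn: "0 \<le> nrm (feat y - feat x)" using x y mem_S by simp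
    have "\<bar>F y - F x\<bar> \<le> B * nrm (feat y - feat x)" using assms x y by blast
    also have "\<dots> \<le> (\<bar>B\<bar> + 1) * nrm (feat y - feat x)" using nn by (intro mult_right_mono) auto
    also have "\<dots> < (\<bar>B\<bar> + 1) * (e / (\<bar>B\<bar> + 1))"
      using d(2)[OF y] by (intro mult_strict_left_mono) auto
    finally show ?thesis by (simp add: dist_real_def)
  qed
  then show "\<exists>d>0. \<forall>y\<in>\<Omega>. dist y x < d \<longrightarrow> dist (F y) (F x) < e" using d(1) by blast
qed

lemma eval_diff_le:
  assumes "f \<in> H" "x \<in> \<Omega>" "y \<in> \<Omega>"
  shows "\<bar>f y - f x\<bar> \<le> nrm f * nrm (feat y - feat x)"
  using Cauchy_Schwarz[of f "feat y - feat x"] assms mem_S by (simp add: ip_linear reproducing)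

lemma continuous_on_mem: "f \<in> H \<Longrightarrow> continuous_on \<Omega> f"
  by (rule continuous_on_via_feat) (rule eval_diff_le)

lemma continuous_on_nrm_feat: "continuous_on \<Omega> (\<lambda>x. nrm (feat x))"
  by (rule continuous_on_via_feat[of _ 1]) (use nrm_triangle_diff in simp)

lemma continuous_on_diagonal: "continuous_on \<Omega> (\<lambda>x. k x x)"
  using continuous_on_power[OF continuous_on_nrm_feat, of 2]
  by (rule continuous_on_eq) (simp add: nrm_sq ip_feat)

definition diag_bound :: real where
  "diag_bound = Sup ((\<lambda>x. nrm (feat x)) ` \<Omega>)"

lemma nrm_feat_le: "x \<in> \<Omega> \<Longrightarrow> nrm (feat x) \<le> diag_bound"
  unfolding diag_bound_def
  using compact_imp_bounded[OF compact_continuous_image[OF continuous_on_nrm_feat compact_dom]]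
  by (intro cSup_upper bounded_imp_bdd_above) auto

lemma eval_le:
  assumes "f \<in> H" "x \<in> \<Omega>"
  shows "\<bar>f x\<bar> \<le> nrm f * diag_bound"
proof -
  have "\<bar>f x\<bar> \<le> nrm f * nrm (feat x)"
    using Cauchy_Schwarz[of f "feat x"] assms by (simp add: reproducing)
  also have "\<dots> \<le> nrm f * diag_bound"
    using assms nrm_feat_le by (intro mult_left_mono) auto
  finally show ?thesis .
qed

section \<open>The embedding into the square integrable functions\<close>

lemma finite_measure_dom: "finite_measure (lebesgue_on \<Omega>)"
  using lmeasurable_compact[OF compact_dom] by (rule finite_measure_lebesgue_on)

lemma dom_sets: "\<Omega> \<in> sets lebesgue"
  using lmeasurable_compact[OF compact_dom] by (rule fmeasurableD)

lemma continuous_integrable: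
  assumes "continuous_on \<Omega> (f :: 'a \<Rightarrow> real)"
  shows "integrable (lebesgue_on \<Omega>) f"
proof -
  obtain B where B: "\<And>x. x \<in> \<Omega> \<Longrightarrow> norm (f x) \<le> B"
    using compact_imp_bounded[OF compact_continuous_image[OF assms compact_dom]]
    unfolding bounded_iff by blast
  show ?thesis
    using B by (intro finite_measure.integrable_const_bound[OF finite_measure_dom, of _ B]
      continuous_imp_measurable_on_sets_lebesgue[OF assms dom_sets]) auto
qed

text \<open>The set where a continuous function does not vanish is relatively open; full support forbids it to be a null
  set unless it is empty.\<close>

lemma continuous_AE_zero:
  assumes "continuous_on \<Omega> (f :: 'a \<Rightarrow> real)" "AE x in lebesgue_on \<Omega>. f x = 0" "x \<in> \<Omega>"
  shows "f x = 0"
proof (rule ccontr)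
  assume "f x \<noteq> 0"
  obtain U where U: "open U" "U \<inter> \<Omega> = f -` (- {0}) \<inter> \<Omega>"
    using assms(1) unfolding continuous_on_open_invariant
    by (metis open_Compl closed_singleton)
  have "AE x in lebesgue. x \<in> \<Omega> \<longrightarrow> f x = 0"
    using assms(2) dom_sets by (subst (asm) AE_restrict_space_iff) auto
  then have "AE x in lebesgue. x \<notin> U \<inter> \<Omega>" by eventually_elim (use U in auto)
  moreover have m: "U \<inter> \<Omega> \<in> sets lebesgue" using U(1) dom_sets by auto
  ultimately have "emeasure lebesgue (U \<inter> \<Omega>) = 0"
    by (subst AE_iff_measurable[OF m, symmetric, of "\<lambda>x. x \<notin> U \<inter> \<Omega>"]) auto
  moreover have "U \<inter> \<Omega> \<noteq> {}" using U assms(3) \<open>f x \<noteq> 0\<close> by blast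
  ultimately show False
    using full_support_dom U(1) unfolding full_support_def by force
qed

lemma AE_eq_imp_eq:
  assumes "f \<in> H" "g \<in> H" "AE x in lebesgue_on \<Omega>. f x = g x"
  shows "f = g"
proof -
  have c: "continuous_on \<Omega> (\<lambda>x. f x - g x)"
    using assms continuous_on_mem by (intro continuous_on_diff) auto
  have "AE x in lebesgue_on \<Omega>. f x - g x = 0" using assms(3) by eventually_elim simp
  then show ?thesis
    using continuous_AE_zero[OF c] assms by (intro eq_on_dom) auto
qed

lemma integrable_prod: "f \<in> H \<Longrightarrow> g \<in> H \<Longrightarrow> integrable (lebesgue_on \<Omega>) (\<lambda>x. f x * g x)"
  using continuous_on_mem by (intro continuous_integrable continuous_on_mult) auto

lemma ip_space_L2: "ip_space H (L2_inner \<Omega>)"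
proof
  show "subspace H" by (rule subspace_S)
  have "f = 0" if f: "f \<in> H" "L2_inner \<Omega> f f = 0" for f
  proof (rule AE_eq_imp_eq[OF f(1) mem_S(1)])
    have "AE x in lebesgue_on \<Omega>. f x * f x = 0"
      using f integral_nonneg_eq_0_iff_AE[OF integrable_prod[OF f(1) f(1)]]
      by (simp add: L2_inner_def)
    then show "AE x in lebesgue_on \<Omega>. f x = 0 x" by eventually_elim simp
  qed
  then show "inner_product_on H (L2_inner \<Omega>)"
    unfolding inner_product_on_def L2_inner_def
    by (auto simp: mult.commute algebra_simps integrable_prod
        intro!: Bochner_Integration.integral_nonneg)
qed

definition embed_const :: real where
  "embed_const = diag_bound\<^sup>2 * measure (lebesgue_on \<Omega>) \<Omega>"

lemma L2_le_sup:
  assumes "f \<in> H" "\<And>x. x \<in> \<Omega> \<Longrightarrow> \<bar>f x\<bar> \<le> B"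
  shows "L2_inner \<Omega> f f \<le> B\<^sup>2 * measure (lebesgue_on \<Omega>) \<Omega>"
proof -
  interpret finite_measure "lebesgue_on \<Omega>" by (rule finite_measure_dom)
  have "L2_inner \<Omega> f f \<le> (LINT x|lebesgue_on \<Omega>. B\<^sup>2)"
    unfolding L2_inner_def
  proof (rule integral_mono[OF integrable_prod[OF assms(1,1)]])
    fix x assume "x \<in> space (lebesgue_on \<Omega>)"
    then show "f x * f x \<le> B\<^sup>2"
      using assms(2)[of x] power_mono[of "\<bar>f x\<bar>" B 2] by (simp add: power2_eq_square)
  qed simp
  then show ?thesis by (simp add: mult.commute)
qed

lemma L2_bound:
  assumes "f \<in> H"
  shows "L2_inner \<Omega> f f \<le> embed_const * ip f f"
  using L2_le_sup[OF assms, of "nrm f * diag_bound"] eval_le[OF assms] assms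
  by (simp add: embed_const_def power_mult_distrib nrm_sq mult_ac)

text \<open>The unit ball is uniformly bounded and equicontinuous, so Arzela--Ascoli gives uniformly convergent subsequences.\<close>

lemma unit_ball_compact:
  assumes s: "\<And>i. s i \<in> H \<and> ip (s i) (s i) \<le> 1"
  shows "\<exists>r. strict_mono (r :: nat \<Rightarrow> nat) \<and>
    (\<forall>e>0. \<exists>N. \<forall>i\<ge>N. \<forall>j\<ge>N. L2_inner \<Omega> (s (r i) - s (r j)) (s (r i) - s (r j)) < e)"
proof -
  have sH: "s i \<in> H" for i using s by blast
  have n1: "nrm (s i) \<le> 1" for i
    using s by (simp add: ip_norm_def)
  obtain g r where g: "continuous_on \<Omega> g" "strict_mono (r :: nat \<Rightarrow> nat)"
    "\<And>e. 0 < e \<Longrightarrow> \<exists>N. \<forall>n x. n \<ge> N \<and> x \<in> \<Omega> \<longrightarrow> norm (s (r n) x - g x) < e"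
  proof (rule Arzela_Ascoli[OF compact_dom, of s "\<bar>diag_bound\<bar>"])
    fix n x assume x: "x \<in> \<Omega>"
    have "\<bar>s n x\<bar> \<le> nrm (s n) * diag_bound" by (rule eval_le[OF sH x])
    also have "\<dots> \<le> nrm (s n) * \<bar>diag_bound\<bar>" using sH by (intro mult_left_mono) auto
    also have "\<dots> \<le> 1 * \<bar>diag_bound\<bar>" using n1 by (intro mult_right_mono) auto
    finally show "norm (s n x) \<le> \<bar>diag_bound\<bar>" by simp
  next
    fix x and e :: real assume x: "x \<in> \<Omega>" and e: "0 < e"
    from feature[OF this] obtain d where d: "d > 0"
      "\<And>y. y \<in> \<Omega> \<Longrightarrow> dist y x < d \<Longrightarrow> nrm (feat y - feat x) < e"
      unfolding feat_def by blast
    have "norm (s n x - s n y) < e" if y: "y \<in> \<Omega>" "norm (x - y) < d" for n y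
    proof -
      have nn: "0 \<le> nrm (feat y - feat x)" using x y mem_S by simp
      have "\<bar>s n y - s n x\<bar> \<le> nrm (s n) * nrm (feat y - feat x)"
        by (rule eval_diff_le[OF sH x y(1)])
      also have "\<dots> \<le> 1 * nrm (feat y - feat x)" using n1 nn by (intro mult_right_mono) auto
      also have "\<dots> < e" using d(2)[of y] y by (simp add: dist_norm norm_minus_commute)
      finally show ?thesis by (simp add: abs_minus_commute)
    qed
    then show "\<exists>d. 0 < d \<and> (\<forall>n y. y \<in> \<Omega> \<and> norm (x - y) < d \<longrightarrow> norm (s n x - s n y) < e)"
      using d(1) by blast
  qed (use that in blast)
  have "\<exists>N. \<forall>i\<ge>N. \<forall>j\<ge>N. L2_inner \<Omega> (s (r i) - s (r j)) (s (r i) - s (r j)) < e" if e: "e > 0" for e :: real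
  proof -
    define m where "m = measure (lebesgue_on \<Omega>) \<Omega>"
    have m: "m \<ge> 0" by (simp add: m_def)
    \<comment> \<open>two functions within \<open>\<delta>\<close> of the uniform limit have squared distance at most \<open>(2 * \<delta>)\<^sup>2 * m = e * m / (m + 1)\<close>\<close>
    define \<delta> where "\<delta> = sqrt (e / (m + 1)) / 2"
    have \<delta>: "\<delta> > 0" using e m by (simp add: \<delta>_def)
    obtain N where N: "\<And>n x. n \<ge> N \<Longrightarrow> x \<in> \<Omega> \<Longrightarrow> \<bar>s (r n) x - g x\<bar> < \<delta>"
      using g(3)[OF \<delta>] by auto
    have "L2_inner \<Omega> (s (r i) - s (r j)) (s (r i) - s (r j)) < e" if "i \<ge> N" "j \<ge> N" for i j
    proof -
      have "L2_inner \<Omega> (s (r i) - s (r j)) (s (r i) - s (r j)) \<le> (2 * \<delta>)\<^sup>2 * m"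
        unfolding m_def
      proof (rule L2_le_sup)
        show "s (r i) - s (r j) \<in> H" using sH mem_S by simp
        fix x assume "x \<in> \<Omega>"
        then have "\<bar>s (r i) x - g x\<bar> < \<delta>" "\<bar>s (r j) x - g x\<bar> < \<delta>" using N that by auto
        then show "\<bar>(s (r i) - s (r j)) x\<bar> \<le> 2 * \<delta>" by simp
      qed
      also have "(2 * \<delta>)\<^sup>2 * m = e * (m / (m + 1))" using e m by (simp add: \<delta>_def)
      also have "\<dots> < e" using e m by (simp add: field_simps)
      finally show ?thesis .
    qed
    then show ?thesis by blast
  qed
  then show ?thesis using g(2) by blast
qed

end

sublocale cont_rkhs \<subseteq> compact_form H ip "L2_inner \<Omega>" embed_const
proof -
  interpret L2: ip_space H "L2_inner \<Omega>" by (rule ip_space_L2)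
  show "compact_form H ip (L2_inner \<Omega>) embed_const"
    by unfold_locales (use L2_bound unit_ball_compact in auto)
qed

context cont_rkhs
begin

section \<open>Eigenfunctions of the integral operator\<close>

text \<open>The integral operator maps into the native space and is the adjoint of the embedding: its values
  are the products of the representer with the kernel sections.\<close>

lemma int_op_representation:
  assumes f: "integrable (lebesgue_on \<Omega>) f"
  obtains h where "h \<in> H" "\<And>g. g \<in> H \<Longrightarrow> ip h g = (LINT y|lebesgue_on \<Omega>. f y * g y)"
    "\<And>x. x \<in> \<Omega> \<Longrightarrow> h x = int_op \<Omega> k f x"
proof -
  define L where "L g = (LINT y|lebesgue_on \<Omega>. f y * g y)" for g
  define F where "F = (LINT y|lebesgue_on \<Omega>. \<bar>f y\<bar>)"
  have meas: "g \<in> borel_measurable (lebesgue_on \<Omega>)" if "g \<in> H" for g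
    using borel_measurable_integrable[OF continuous_integrable[OF continuous_on_mem[OF that]]] .
  have int_abs: "integrable (lebesgue_on \<Omega>) (\<lambda>y. \<bar>f y\<bar> * B)" for B
    using f by simp
  have le: "\<bar>f y * g y\<bar> \<le> \<bar>f y\<bar> * (nrm g * diag_bound)" if "g \<in> H" "y \<in> \<Omega>" for g y
    using eval_le[OF that] by (simp add: abs_mult mult_left_mono)
  have int: "integrable (lebesgue_on \<Omega>) (\<lambda>y. f y * g y)" if g: "g \<in> H" for g
    by (rule Bochner_Integration.integrable_bound[OF int_abs[of "nrm g * diag_bound"]])
      (use le[OF g] meas[OF g] f in \<open>auto intro!: AE_I2 order_trans[OF _ abs_ge_self] borel_measurable_times\<close>)
  obtain h where h: "h \<in> H" "\<And>g. g \<in> H \<Longrightarrow> ip h g = L g"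
  proof (rule Riesz[OF closed_subspace_self, of L "F * diag_bound"])
    fix g assume g: "g \<in> H"
    have "\<bar>L g\<bar> \<le> (LINT y|lebesgue_on \<Omega>. \<bar>f y * g y\<bar>)"
      unfolding L_def by (rule integral_abs_bound)
    also have "\<dots> \<le> (LINT y|lebesgue_on \<Omega>. \<bar>f y\<bar> * (nrm g * diag_bound))"
      using le[OF g] int[OF g] int_abs by (intro integral_mono) auto
    also have "\<dots> = F * diag_bound * nrm g" by (simp add: F_def)
    finally show "\<bar>L g\<bar> \<le> F * diag_bound * nrm g" .
  qed (use int that in \<open>simp_all add: L_def algebra_simps\<close>)
  have "h x = int_op \<Omega> k f x" if x: "x \<in> \<Omega>" for x
  proof -
    have "h x = L (feat x)" using h x reproducing[of h x] by simp
    also have "\<dots> = int_op \<Omega> k f x"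
      unfolding L_def int_op_def
      by (rule Bochner_Integration.integral_cong)
        (auto simp: feat_def zero_ext_def kernel_commute[OF x] mult.commute)
    finally show ?thesis .
  qed
  then show ?thesis using that h by (simp add: L_def)
qed

lemma continuous_L2: "continuous_on \<Omega> f \<Longrightarrow> f \<in> L2 \<Omega>"
  unfolding L2_def
  by (auto intro!: continuous_integrable continuous_on_power borel_measurable_integrable)

lemma L2_integrable:
  assumes "f \<in> L2 \<Omega>"
  shows "integrable (lebesgue_on \<Omega>) f"
proof -
  interpret finite_measure "lebesgue_on \<Omega>" by (rule finite_measure_dom)
  have "integrable (lebesgue_on \<Omega>) (\<lambda>x. 1 + (f x)\<^sup>2)" using assms by (simp add: L2_def)
  moreover have "\<bar>f x\<bar> \<le> 1 + (f x)\<^sup>2" for x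
    using sum_squares_bound[of 1 "\<bar>f x\<bar>"] by (simp add: power2_eq_square)
  ultimately show ?thesis
    using assms by (intro Bochner_Integration.integrable_bound[of _ "\<lambda>x. 1 + (f x)\<^sup>2" f]) (auto simp: L2_def)
qed

lemma form_eigenspace_in_eigenspace:
  assumes "f \<in> form_eigenspace \<mu>"
  shows "f \<in> eigenspace \<Omega> k \<mu>"
proof -
  have f: "f \<in> H" using assms by (simp add: form_eigenspace_def)
  have "int_op \<Omega> k f x = \<mu> * f x" if x: "x \<in> \<Omega>" for x
  proof -
    have "int_op \<Omega> k f x = L2_inner \<Omega> f (feat x)"
      unfolding L2_inner_def int_op_def
      by (rule Bochner_Integration.integral_cong)
        (auto simp: feat_def zero_ext_def kernel_commute[OF x] mult.commute)
    then show ?thesis using assms x f by (simp add: form_eigenspace_def reproducing)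
  qed
  then show ?thesis
    using f by (auto simp: eigenspace_def continuous_L2 continuous_on_mem intro!: AE_I2)
qed

lemma eigenspace_in_form_eigenspace:
  assumes f: "f \<in> H" and ae: "AE x in lebesgue_on \<Omega>. int_op \<Omega> k f x = \<mu> * f x"
  shows "f \<in> form_eigenspace \<mu>"
proof -
  obtain h where h: "h \<in> H" "\<And>g. g \<in> H \<Longrightarrow> ip h g = (LINT y|lebesgue_on \<Omega>. f y * g y)"
    "\<And>x. x \<in> \<Omega> \<Longrightarrow> h x = int_op \<Omega> k f x"
    using int_op_representation[OF continuous_integrable[OF continuous_on_mem[OF f]]] by blast
  have "h = \<mu> *\<^sub>R f"
  proof (rule AE_eq_imp_eq[OF h(1)])
    show "\<mu> *\<^sub>R f \<in> H" using f mem_S by simp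
    have "AE x in lebesgue_on \<Omega>. x \<in> \<Omega>" by (rule AE_I2) simp
    then show "AE x in lebesgue_on \<Omega>. h x = (\<mu> *\<^sub>R f) x" using ae by eventually_elim (simp add: h(3))
  qed
  then have "L2_inner \<Omega> f g = \<mu> * ip f g" if "g \<in> H" for g
    using h(2)[OF that] f that by (simp add: L2_inner_def ip_linear)
  then show ?thesis using f by (simp add: form_eigenspace_def)
qed

text \<open>For \<open>\<mu> > 0\<close> a square integrable eigenfunction is \<open>1 / \<mu>\<close> times its image under the operator, and that image has a
  representative in the native space.\<close>

lemma eigenspace_AE_form_eigenspace:
  assumes f: "f \<in> eigenspace \<Omega> k \<mu>" and mu: "\<mu> > 0"
  obtains g where "g \<in> form_eigenspace \<mu>" "AE x in lebesgue_on \<Omega>. f x = g x"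
proof -
  have fL: "f \<in> L2 \<Omega>" and ae: "AE x in lebesgue_on \<Omega>. int_op \<Omega> k f x = \<mu> * f x"
    using f by (auto simp: eigenspace_def)
  obtain h where "h \<in> H" "\<And>g. g \<in> H \<Longrightarrow> ip h g = (LINT y|lebesgue_on \<Omega>. f y * g y)"
    "\<And>x. x \<in> \<Omega> \<Longrightarrow> h x = int_op \<Omega> k f x"
    using int_op_representation[OF L2_integrable[OF fL]] by blast
  note h = this(1,3)
  define g where "g = (1 / \<mu>) *\<^sub>R h"
  have g: "g \<in> H" using h mem_S by (simp add: g_def)
  have dom: "AE x in lebesgue_on \<Omega>. x \<in> \<Omega>" by (rule AE_I2) simp
  have fg: "AE x in lebesgue_on \<Omega>. f x = g x"
    using dom ae by eventually_elim (use mu h(2) in \<open>simp add: g_def\<close>)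
  have op_eq: "int_op \<Omega> k g x = int_op \<Omega> k f x" if x: "x \<in> \<Omega>" for x
    unfolding int_op_def
  proof (rule integral_cong_AE)
    have "(\<lambda>y. k x y) \<in> borel_measurable (lebesgue_on \<Omega>) \<longleftrightarrow> feat x \<in> borel_measurable (lebesgue_on \<Omega>)"
      by (rule measurable_cong) (simp add: feat_def zero_ext_def kernel_commute[OF x])
    then have kx: "(\<lambda>y. k x y) \<in> borel_measurable (lebesgue_on \<Omega>)"
      using borel_measurable_integrable[OF continuous_integrable[OF continuous_on_mem[OF feat_mem[OF x]]]]
      by blast
    show "(\<lambda>y. k x y * g y) \<in> borel_measurable (lebesgue_on \<Omega>)"
      using kx borel_measurable_integrable[OF continuous_integrable[OF continuous_on_mem[OF g]]]
      by (rule borel_measurable_times)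
    show "(\<lambda>y. k x y * f y) \<in> borel_measurable (lebesgue_on \<Omega>)"
      using kx fL by (intro borel_measurable_times) (auto simp: L2_def)
    show "AE y in lebesgue_on \<Omega>. k x y * g y = k x y * f y" using fg by eventually_elim simp
  qed
  have "AE x in lebesgue_on \<Omega>. int_op \<Omega> k g x = \<mu> * g x"
    using dom ae fg by eventually_elim (simp add: op_eq)
  then show ?thesis using eigenspace_in_form_eigenspace[OF g] fg that by blast
qed

lemma sum_fun_apply: "(\<Sum>i\<in>A. u i) x = (\<Sum>i\<in>A. u i x)" for u :: "'i \<Rightarrow> 'a \<Rightarrow> real"
  by (induction A rule: infinite_finite_induct) auto

text \<open>Passing to the representatives in the native space turns a basis modulo null sets into a genuine basis, because two
  functions of the space that agree almost everywhere are equal.\<close>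

lemma form_eigenspace_basis:
  assumes mu: "\<mu> > 0" and dim: "L2_has_dim \<Omega> (eigenspace \<Omega> k \<mu>) m"
  shows "\<exists>F. finite F \<and> independent F \<and> span F = form_eigenspace \<mu> \<and> card F = m"
proof -
  obtain b where b: "\<And>i. i < m \<Longrightarrow> b i \<in> eigenspace \<Omega> k \<mu>"
      "\<And>c. AE x in lebesgue_on \<Omega>. (\<Sum>i<m. c i * b i x) = 0 \<Longrightarrow> \<forall>i<m. c i = 0"
      "\<And>f. f \<in> eigenspace \<Omega> k \<mu> \<Longrightarrow> \<exists>c. AE x in lebesgue_on \<Omega>. f x = (\<Sum>i<m. c i * b i x)"
    using dim unfolding L2_has_dim_def by blast
  have "\<exists>g. g \<in> form_eigenspace \<mu> \<and> (AE x in lebesgue_on \<Omega>. b i x = g x)" if "i < m" for i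
    using eigenspace_AE_form_eigenspace[OF b(1)[OF that] mu] by metis
  then obtain g where g: "\<And>i. i < m \<Longrightarrow> g i \<in> form_eigenspace \<mu>"
      "\<And>i. i < m \<Longrightarrow> AE x in lebesgue_on \<Omega>. b i x = g i x" by metis
  have gH: "g i \<in> H" if "i < m" for i using g(1)[OF that] by (simp add: form_eigenspace_def)
  have ae: "AE x in lebesgue_on \<Omega>. (\<Sum>i<m. c i * b i x) = (\<Sum>i<m. c i *\<^sub>R g i) x" for c
  proof -
    have "AE x in lebesgue_on \<Omega>. \<forall>i\<in>{..<m}. b i x = g i x"
      using g(2) by (intro AE_finite_allI) auto
    then show ?thesis by eventually_elim (simp add: sum_fun_apply)
  qed
  have zero: "\<forall>i<m. c i = 0" if "(\<Sum>i<m. c i *\<^sub>R g i) = 0" for c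
    using b(2)[of c] ae[of c] that by simp
  have inj: "inj_on g {..<m}"
  proof (rule inj_onI, rule ccontr)
    fix i j assume ij: "i \<in> {..<m}" "j \<in> {..<m}" "g i = g j" "i \<noteq> j"
    let ?c = "\<lambda>l. (if l = i then 1 else 0) - (if l = j then 1 else 0 :: real)"
    have "(\<Sum>l<m. ?c l *\<^sub>R g l) = (\<Sum>l<m. if l = i then g l else 0) - (\<Sum>l<m. if l = j then g l else 0)"
      by (subst sum_subtractf[symmetric], rule sum.cong) (auto simp: scaleR_diff_left)
    then have "(\<Sum>l<m. ?c l *\<^sub>R g l) = 0" using ij by simp
    then have "?c i = 0" using zero[of ?c] ij by blast
    then show False using ij by simp
  qed
  have "independent (g ` {..<m})"
  proof
    assume "dependent (g ` {..<m})"
    then obtain u v where u: "v \<in> g ` {..<m}" "u v \<noteq> 0" "(\<Sum>w\<in>g ` {..<m}. u w *\<^sub>R w) = 0"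
      by (auto simp: dependent_finite)
    then have "(\<Sum>i<m. u (g i) *\<^sub>R g i) = 0" by (simp add: sum.reindex[OF inj])
    then show False using zero[of "u \<circ> g"] u by auto
  qed
  moreover have "span (g ` {..<m}) = form_eigenspace \<mu>"
  proof
    show "span (g ` {..<m}) \<subseteq> form_eigenspace \<mu>" using g(1) subspace_form_eigenspace by (intro span_minimal) auto
    show "form_eigenspace \<mu> \<subseteq> span (g ` {..<m})"
    proof
      fix f assume f: "f \<in> form_eigenspace \<mu>"
      obtain c where c: "AE x in lebesgue_on \<Omega>. f x = (\<Sum>i<m. c i * b i x)"
        using b(3)[OF form_eigenspace_in_eigenspace[OF f]] by blast
      have "f = (\<Sum>i<m. c i *\<^sub>R g i)"
      proof (rule AE_eq_imp_eq)
        show "f \<in> H" using f by (simp add: form_eigenspace_def)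
        show "(\<Sum>i<m. c i *\<^sub>R g i) \<in> H" using gH by (intro mem_S) auto
        show "AE x in lebesgue_on \<Omega>. f x = (\<Sum>i<m. c i *\<^sub>R g i) x"
          using c ae[of c] by eventually_elim simp
      qed
      moreover have "(\<Sum>i<m. c i *\<^sub>R g i) \<in> span (g ` {..<m})"
        by (intro span_sum span_scale span_base imageI)
      ultimately show "f \<in> span (g ` {..<m})" by simp
    qed
  qed
  ultimately show ?thesis using inj by (intro exI[of _ "g ` {..<m}"]) (simp add: card_image)
qed

lemma eigenvalue_enum_eigen_enum:
  assumes "eigenvalue_enum \<Omega> k I ev"
  shows "eigen_enum H ip (L2_inner \<Omega>) embed_const I ev"
  by unfold_locales (use assms form_eigenspace_basis in \<open>auto simp: eigenvalue_enum_def\<close>)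

lemma eigenfunctions_iff:
  assumes "eigen_enum H ip (L2_inner \<Omega>) embed_const I ev"
  shows "eigenfunctions \<Omega> k H I ev \<phi> \<longleftrightarrow> eigen_enum.eigenfamily H ip (L2_inner \<Omega>) I ev \<phi>"
proof -
  interpret eigen_enum H ip "L2_inner \<Omega>" embed_const I ev by (rule assms)
  have "\<phi> j \<in> H \<and> \<phi> j \<in> eigenspace \<Omega> k (ev j) \<longleftrightarrow> \<phi> j \<in> form_eigenspace (ev j)" for j
    using form_eigenspace_in_eigenspace[of "\<phi> j" "ev j"] eigenspace_in_form_eigenspace[of "\<phi> j" "ev j"]
      subsetD[OF form_eigenspace_subset, of "\<phi> j" "ev j"]
    by (auto simp: eigenspace_def[of \<Omega> k])
  then show ?thesis by (auto simp: eigenfunctions_def eigenfamily_def)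
qed

section \<open>The trace formula\<close>

text \<open>Parseval's identity for the kernel section at \<open>x\<close> reads \<open>k x x = \<Sum>j. e\<^sub>j(x)\<^sup>2\<close>, and for \<open>j \<in> I\<close> the
  squared \<open>L\<^sub>2\<close> norm of \<open>e\<^sub>j\<close> is \<open>ev j\<close>.  The partial
  sums are dominated by \<open>k x x\<close>, so integration may be done term by term.\<close>

theorem trace_formula:
  assumes ev: "eigenvalue_enum \<Omega> k I ev"
  shows "(ev has_sum (LINT x|lebesgue_on \<Omega>. k x x)) I"
proof -
  interpret eigen_enum H ip "L2_inner \<Omega>" embed_const I ev
    by (rule eigenvalue_enum_eigen_enum[OF ev])
  obtain \<phi> where \<phi>: "eigenfamily \<phi>" using eigenfamily_exists by blast
  define b where "b = native_basis \<phi>"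
  have bH: "b j \<in> H" for j unfolding b_def by (rule native_basis_mem[OF \<phi>])
  have sums: "(\<lambda>j. (b j x)\<^sup>2) sums k x x" if x: "x \<in> \<Omega>" for x
  proof -
    have "ip (feat x) (b j) = b j x" for j
      using ip_comm[OF feat_mem[OF x] bH] reproducing[OF bH x] by simp
    then show ?thesis
      using native_basis_expansion(2)[OF \<phi> feat_mem[OF x]] ip_feat[OF x x] by (simp add: b_def)
  qed
  have "(\<lambda>N. LINT x|lebesgue_on \<Omega>. (\<Sum>j<N. (b j x)\<^sup>2)) \<longlonglongrightarrow> (LINT x|lebesgue_on \<Omega>. k x x)"
  proof (rule integral_dominated_convergence)
    have kk: "integrable (lebesgue_on \<Omega>) (\<lambda>x. k x x)"
      by (rule continuous_integrable[OF continuous_on_diagonal])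
    then show "integrable (lebesgue_on \<Omega>) (\<lambda>x. k x x)" "(\<lambda>x. k x x) \<in> borel_measurable (lebesgue_on \<Omega>)"
      by auto
    show "(\<lambda>x. \<Sum>j<N. (b j x)\<^sup>2) \<in> borel_measurable (lebesgue_on \<Omega>)" for N
      by (intro borel_measurable_integrable continuous_integrable continuous_on_sum
          continuous_on_power continuous_on_mem bH)
    show "AE x in lebesgue_on \<Omega>. (\<lambda>N. \<Sum>j<N. (b j x)\<^sup>2) \<longlonglongrightarrow> k x x"
      using sums by (intro AE_I2) (simp add: sums_def)
    show "AE x in lebesgue_on \<Omega>. norm (\<Sum>j<N. (b j x)\<^sup>2) \<le> k x x" for N
    proof (rule AE_I2)
      fix x assume "x \<in> space (lebesgue_on \<Omega>)"
      then have "(\<lambda>j. (b j x)\<^sup>2) sums k x x" using sums by simp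
      then have "(\<Sum>j<N. (b j x)\<^sup>2) \<le> k x x"
        using sum_le_suminf[of "\<lambda>j. (b j x)\<^sup>2" "{..<N}"] by (auto simp: sums_iff)
      then show "norm (\<Sum>j<N. (b j x)\<^sup>2) \<le> k x x" by (simp add: sum_nonneg)
    qed
  qed
  moreover have "(LINT x|lebesgue_on \<Omega>. (\<Sum>j<N. (b j x)\<^sup>2)) = (\<Sum>j<N. if j \<in> I then ev j else 0)" for N
  proof -
    have "(LINT x|lebesgue_on \<Omega>. (b j x)\<^sup>2) = (if j \<in> I then ev j else 0)" for j
    proof (cases "j \<in> I")
      case True
      then show ?thesis
        using q_native_basis_self[OF \<phi> True] by (simp add: b_def L2_inner_def power2_eq_square)
    qed (simp add: b_def native_basis_def[OF \<phi>])
    moreover have "integrable (lebesgue_on \<Omega>) (\<lambda>x. (b j x)\<^sup>2)" for j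
      by (intro continuous_integrable continuous_on_power continuous_on_mem bH)
    ultimately show ?thesis by simp
  qed
  ultimately have "(\<lambda>j. if j \<in> I then ev j else 0) sums (LINT x|lebesgue_on \<Omega>. k x x)"
    by (simp add: sums_def)
  then have "((\<lambda>j. if j \<in> I then ev j else 0) has_sum (LINT x|lebesgue_on \<Omega>. k x x)) UNIV"
    by (rule sums_nonneg_imp_has_sum) (use lam_pos in \<open>auto intro: less_imp_le\<close>)
  moreover have "((\<lambda>j. if j \<in> I then ev j else 0) has_sum s) UNIV \<longleftrightarrow> (ev has_sum s) I" for s
    by (rule has_sum_cong_neutral) auto
  ultimately show ?thesis by blast
qed

section \<open>The power function\<close>

text \<open>The residual of the projection is self-adjoint, so \<open>f - \<Pi> f\<close> evaluated at \<open>x\<close> is the product of \<open>f\<close> with the residual of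
  the kernel section; its supremum over the unit ball is the norm of that residual.\<close>

lemma power_function_eq:
  assumes W: "projectable W" and x: "x \<in> \<Omega>"
  shows "power_function H ip W x = nrm (feat x - orth_proj ip W (feat x))"
proof -
  define r where "r = feat x - orth_proj ip W (feat x)"
  have kH: "feat x \<in> H" using x by simp
  note P = orth_proj_props[OF W]
  have rH: "r \<in> H" using kH P(2) mem_S by (simp add: r_def)
  have key: "f x - orth_proj ip W f x = ip f r" if f: "f \<in> H" for f
  proof -
    have "ip (orth_proj ip W f) (feat x) = ip f (orth_proj ip W (feat x))"
      using P(4)[OF f P(1)[OF kH]] P(4)[OF kH P(1)[OF f]]
        ip_comm[OF P(2)[OF f] P(2)[OF kH]] ip_comm[OF kH P(2)[OF f]] by simp
    then show ?thesis
      using f x kH P(2)[OF f] P(2)[OF kH] reproducing by (simp add: r_def ip_linear)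
  qed
  have "power_function H ip W x = Sup {\<bar>ip f r\<bar> | f. f \<in> H \<and> nrm f \<le> 1}"
    unfolding power_function_def using key by (intro arg_cong[of _ _ Sup]) (auto, metis+)
  also have "\<dots> = nrm r"
  proof (rule cSup_eq_maximum)
    show "nrm r \<in> {\<bar>ip f r\<bar> | f. f \<in> H \<and> nrm f \<le> 1}"
    proof (cases "r = 0")
      case True
      then show ?thesis using mem_S(1) rH nrm_zero_iff[OF mem_S(1)] by (intro CollectI exI[of _ 0]) auto
    next
      case False
      then have n: "nrm r \<noteq> 0" using rH nrm_zero_iff by simp
      have "\<bar>ip ((1 / nrm r) *\<^sub>R r) r\<bar> = nrm r"
        using n rH by (simp add: ip_linear nrm_sq[symmetric] power2_eq_square)
      moreover have "nrm ((1 / nrm r) *\<^sub>R r) = 1" using n rH nrm_nonneg[OF rH] by (simp add: nrm_scale)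
      ultimately show ?thesis
        using rH mem_S by (intro CollectI exI[of _ "(1 / nrm r) *\<^sub>R r"]) auto
    qed
    fix y assume "y \<in> {\<bar>ip f r\<bar> | f. f \<in> H \<and> nrm f \<le> 1}"
    then obtain f where f: "f \<in> H" "nrm f \<le> 1" "y = \<bar>ip f r\<bar>" by blast
    have "y \<le> nrm f * nrm r" using f Cauchy_Schwarz[OF f(1) rH] by simp
    also have "\<dots> \<le> 1 * nrm r" using f rH by (intro mult_right_mono) auto
    finally show "y \<le> nrm r" by simp
  qed
  finally show ?thesis by (simp add: r_def)
qed

theorem power_function_L2:
  assumes W: "projectable W"
  shows "power_function H ip W \<in> L2 \<Omega>"
    and "L2_norm \<Omega> (power_function H ip W) = sqrt ((LINT x|lebesgue_on \<Omega>. k x x) -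
      (LINT x|lebesgue_on \<Omega>. ip (orth_proj ip W (feat x)) (orth_proj ip W (feat x))))"
proof -
  let ?P = "\<lambda>x. orth_proj ip W (feat x)"
  note P = orth_proj_props[OF W] nrm_orth_proj_le[OF W]
  have "continuous_on \<Omega> (power_function H ip W)"
  proof (rule continuous_on_via_feat[of _ 1])
    fix x y assume xy: "x \<in> \<Omega>" "y \<in> \<Omega>"
    then have H: "feat x \<in> H" "feat y \<in> H" "feat y - feat x \<in> H" "feat x - ?P x \<in> H" "feat y - ?P y \<in> H"
      using P(2) mem_S by auto
    have "\<bar>nrm (feat y - ?P y) - nrm (feat x - ?P x)\<bar> \<le> nrm ((feat y - ?P y) - (feat x - ?P x))"
      using H by (intro nrm_triangle_diff)
    also have "(feat y - ?P y) - (feat x - ?P x) = (feat y - feat x) - orth_proj ip W (feat y - feat x)"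
      using orth_proj_diff[OF W H(2,1)] by simp
    also have "nrm \<dots> \<le> nrm (feat y - feat x)" using P(6)[OF H(3)] .
    finally show "\<bar>power_function H ip W y - power_function H ip W x\<bar> \<le> 1 * nrm (feat y - feat x)"
      unfolding power_function_eq[OF W xy(1)] power_function_eq[OF W xy(2)] mult_1_left .
  qed
  then show "power_function H ip W \<in> L2 \<Omega>" by (rule continuous_L2)
  have "continuous_on \<Omega> (\<lambda>x. nrm (?P x))"
  proof (rule continuous_on_via_feat[of _ 1])
    fix x y assume xy: "x \<in> \<Omega>" "y \<in> \<Omega>"
    then have H: "feat x \<in> H" "feat y \<in> H" "feat y - feat x \<in> H" using mem_S by auto
    have "\<bar>nrm (?P y) - nrm (?P x)\<bar> \<le> nrm (?P y - ?P x)"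
      using P(2) H by (intro nrm_triangle_diff) auto
    also have "\<dots> \<le> nrm (feat y - feat x)"
      using P(5)[OF H(3)] orth_proj_diff[OF W H(2,1)] by simp
    finally show "\<bar>nrm (?P y) - nrm (?P x)\<bar> \<le> 1 * nrm (feat y - feat x)" by simp
  qed
  then have "continuous_on \<Omega> (\<lambda>x. (nrm (?P x))\<^sup>2)" by (rule continuous_on_power)
  then have int: "integrable (lebesgue_on \<Omega>) (\<lambda>x. ip (?P x) (?P x))"
    using P(2) by (intro continuous_integrable)
      (subst continuous_on_cong[OF refl, of _ _ "\<lambda>x. (nrm (?P x))\<^sup>2"], auto simp: nrm_sq)
  have "(LINT x|lebesgue_on \<Omega>. (power_function H ip W x)\<^sup>2) =
      (LINT x|lebesgue_on \<Omega>. k x x - ip (?P x) (?P x))"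
  proof (rule Bochner_Integration.integral_cong[OF refl])
    fix x assume "x \<in> space (lebesgue_on \<Omega>)"
    then have x: "x \<in> \<Omega>" by simp
    then have "(power_function H ip W x)\<^sup>2 = ip (feat x - ?P x) (feat x - ?P x)"
      using power_function_eq[OF W x] P(2) mem_S by (simp add: nrm_sq)
    then show "(power_function H ip W x)\<^sup>2 = k x x - ip (?P x) (?P x)"
      using orth_proj_Pythagoras[OF W feat_mem[OF x]] x by (simp add: ip_feat)
  qed
  also have "\<dots> = (LINT x|lebesgue_on \<Omega>. k x x) - (LINT x|lebesgue_on \<Omega>. ip (?P x) (?P x))"
    using int continuous_integrable[OF continuous_on_diagonal] by (rule Bochner_Integration.integral_diff[rotated])
  finally show "L2_norm \<Omega> (power_function H ip W) = sqrt ((LINT x|lebesgue_on \<Omega>. k x x) -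
      (LINT x|lebesgue_on \<Omega>. ip (?P x) (?P x)))"
    by (simp add: L2_norm_def)
qed

lemma power_function_span:
  assumes U: "ortho U" "finite U"
  shows "power_function H ip (span U) \<in> L2 \<Omega>"
    and "L2_norm \<Omega> (power_function H ip (span U)) =
      sqrt ((LINT x|lebesgue_on \<Omega>. k x x) - (\<Sum>u\<in>U. L2_inner \<Omega> u u))"
proof -
  note W = span_ortho_projectable[OF U]
  have UH: "u \<in> H" if "u \<in> U" for u using that U by (auto simp: ortho_def)
  show "power_function H ip (span U) \<in> L2 \<Omega>" by (rule power_function_L2(1)[OF W])
  have "(LINT x|lebesgue_on \<Omega>. ip (orth_proj ip (span U) (feat x)) (orth_proj ip (span U) (feat x))) =
      (LINT x|lebesgue_on \<Omega>. (\<Sum>u\<in>U. u x * u x))"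
  proof (rule Bochner_Integration.integral_cong[OF refl])
    fix x assume "x \<in> space (lebesgue_on \<Omega>)"
    then have x: "x \<in> \<Omega>" by simp
    have "(ip (feat x) u)\<^sup>2 = u x * u x" if "u \<in> U" for u
      using ip_comm[OF feat_mem[OF x] UH[OF that]] reproducing[OF UH[OF that] x]
      by (simp add: power2_eq_square)
    then show "ip (orth_proj ip (span U) (feat x)) (orth_proj ip (span U) (feat x)) = (\<Sum>u\<in>U. u x * u x)"
      using x by (simp add: orth_proj_span[OF U] nrm_proj_sum[OF U])
  qed
  also have "\<dots> = (\<Sum>u\<in>U. L2_inner \<Omega> u u)"
    unfolding L2_inner_def using UH integrable_prod by (intro Bochner_Integration.integral_sum) auto
  finally show "L2_norm \<Omega> (power_function H ip (span U)) =
      sqrt ((LINT x|lebesgue_on \<Omega>. k x x) - (\<Sum>u\<in>U. L2_inner \<Omega> u u))"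
    using power_function_L2(2)[OF W] by simp
qed

section \<open>Closed subspaces\<close>

context
  fixes V assumes V: "closed_subspace H ip V"
begin

text \<open>Projecting in one variable already gives a function that is symmetric in both, and it lies in \<open>V\<close>; the second projection
  does not change it.\<close>

lemma zero_ext_subspace_kernel:
  assumes y: "y \<in> \<Omega>"
  shows "zero_ext \<Omega> (\<lambda>x. subspace_kernel \<Omega> k ip V x y) = orth_proj ip V (feat y)"
proof -
  have W: "projectable V" by (rule closed_subspace_projectable[OF V])
  have VH: "V \<subseteq> H" using V by (simp add: closed_subspace_def)
  note P = orth_proj_props[OF W]
  have inner: "zero_ext \<Omega> (\<lambda>s. orth_proj ip V (zero_ext \<Omega> (\<lambda>t. k s t)) y) = orth_proj ip V (feat y)"
  proof
    fix s
    show "zero_ext \<Omega> (\<lambda>s. orth_proj ip V (zero_ext \<Omega> (\<lambda>t. k s t)) y) s = orth_proj ip V (feat y) s"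
    proof (cases "s \<in> \<Omega>")
      case s: True
      have "zero_ext \<Omega> (\<lambda>t. k s t) = feat s"
        unfolding feat_def zero_ext_def using kernel_commute[OF s] by auto
      moreover have "orth_proj ip V (feat s) y = orth_proj ip V (feat y) s"
      proof -
        have H: "feat s \<in> H" "feat y \<in> H" using s y by auto
        have "orth_proj ip V (feat s) y = ip (orth_proj ip V (feat s)) (feat y)"
          using reproducing[OF P(2)[OF H(1)] y] by simp
        also have "\<dots> = ip (orth_proj ip V (feat y)) (orth_proj ip V (feat s))"
          using P(4)[OF H(2) P(1)[OF H(1)]] ip_comm[OF P(2)[OF H(1)] H(2)] by simp
        also have "\<dots> = ip (orth_proj ip V (feat y)) (feat s)"
          using P(4)[OF H(1) P(1)[OF H(2)]] ip_comm[OF P(2)[OF H(2)] H(1)]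
            ip_comm[OF P(2)[OF H(2)] P(2)[OF H(1)]] by simp
        also have "\<dots> = orth_proj ip V (feat y) s"
          using reproducing[OF P(2)[OF H(2)] s] by simp
        finally show ?thesis .
      qed
      ultimately show ?thesis using s by (simp add: zero_ext_def)
    next
      case False
      then show ?thesis using zero_outside[OF P(2)[OF feat_mem[OF y]]] by (simp add: zero_ext_def)
    qed
  qed
  have "orth_proj ip V (orth_proj ip V (feat y)) = orth_proj ip V (feat y)"
    by (rule orth_proj_id[OF W P(1)[OF feat_mem[OF y]]])
  then have "subspace_kernel \<Omega> k ip V x y = orth_proj ip V (feat y) x" for x
    by (simp add: subspace_kernel_def inner)
  then show ?thesis
    using zero_outside[OF P(2)[OF feat_mem[OF y]]] by (auto simp: zero_ext_def)
qed

theorem closed_subspace_rkhs: "cont_rkhs \<Omega> (subspace_kernel \<Omega> k ip V) V ip"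
proof
  have W: "projectable V" by (rule closed_subspace_projectable[OF V])
  have VH: "V \<subseteq> H" and sV: "subspace V" using V by (auto simp: closed_subspace_def)
  note P = orth_proj_props[OF W]
  show "compact \<Omega>" "full_support \<Omega>" by (rule compact_dom full_support_dom)+
  have "inner_product_on V ip"
    unfolding inner_product_on_def
  proof (intro conjI ballI allI impI)
    fix f g assume "f \<in> V" "g \<in> V"
    then show "ip f g = ip g f" using ip_comm VH by blast
  qed (use VH ip_definite in \<open>auto simp: ip_linear ip_nonneg subset_iff\<close>)
  moreover have "complete_on V ip"
    unfolding complete_on_def
  proof (intro allI impI)
    fix s :: "nat \<Rightarrow> _"
    assume s: "(\<forall>i. s i \<in> V) \<and> (\<forall>e>0. \<exists>N. \<forall>i\<ge>N. \<forall>j\<ge>N. nrm (s i - s j) < e)"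
    then obtain l where "l \<in> V" "(\<lambda>i. nrm (s i - l)) \<longlonglongrightarrow> 0"
      using complete_closed[OF V, of s] by blast
    then show "\<exists>l\<in>V. (\<lambda>i. nrm (s i - l)) \<longlonglongrightarrow> 0" by blast
  qed
  moreover have "ip f (orth_proj ip V (feat x)) = f x" if "f \<in> V" "x \<in> \<Omega>" for f x
  proof -
    have H: "f \<in> H" "feat x \<in> H" using that VH by auto
    show ?thesis
      using P(4)[OF H(2) that(1)] ip_comm[OF H(1) P(2)[OF H(2)]] ip_comm[OF H] reproducing[OF H(1) that(2)]
      by simp
  qed
  ultimately show "native_space \<Omega> (subspace_kernel \<Omega> k ip V) V ip"
    unfolding native_space_def
    using sV VH zero_outside P(1) by (auto simp: zero_ext_subspace_kernel subset_iff)
  fix x and e :: real assume x: "x \<in> \<Omega>" and e: "e > 0"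
  from feature[OF this] obtain d where d: "d > 0"
    "\<And>y. y \<in> \<Omega> \<Longrightarrow> dist y x < d \<Longrightarrow> nrm (feat y - feat x) < e"
    unfolding feat_def by blast
  have "nrm (orth_proj ip V (feat y) - orth_proj ip V (feat x)) < e" if y: "y \<in> \<Omega>" "dist y x < d" for y
  proof -
    have H: "feat y \<in> H" "feat x \<in> H" "feat y - feat x \<in> H" using x y mem_S by auto
    show ?thesis
      using nrm_orth_proj_le(1)[OF W H(3)] orth_proj_diff[OF W H(1,2)] d(2)[OF y] by simp
  qed
  then show "\<exists>d>0. \<forall>y\<in>\<Omega>. dist y x < d \<longrightarrow>
      nrm (zero_ext \<Omega> (\<lambda>t. subspace_kernel \<Omega> k ip V t y) - zero_ext \<Omega> (\<lambda>t. subspace_kernel \<Omega> k ip V t x)) < e"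
    using d(1) x by (auto simp: zero_ext_subspace_kernel)
qed

lemma subspace_kernel_diagonal:
  assumes x: "x \<in> \<Omega>"
  shows "subspace_kernel \<Omega> k ip V x x = ip (orth_proj ip V (feat x)) (orth_proj ip V (feat x))"
proof -
  have W: "projectable V" by (rule closed_subspace_projectable[OF V])
  note P = orth_proj_props[OF W feat_mem[OF x]]
  have "subspace_kernel \<Omega> k ip V x x = orth_proj ip V (feat x) x"
    using fun_cong[OF zero_ext_subspace_kernel[OF x], of x] x by (simp add: zero_ext_def)
  also have "\<dots> = ip (orth_proj ip V (feat x)) (feat x)" using reproducing[OF P(2) x] by simp
  also have "\<dots> = ip (orth_proj ip V (feat x)) (orth_proj ip V (feat x))"
    using P(4)[OF P(1)] ip_comm[OF P(2) feat_mem[OF x]] by simp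
  finally show ?thesis .
qed

end

end

lemma cont_rkhs_of_continuous_kernel:
  fixes \<Omega> :: "'a::euclidean_space set"
  assumes \<Omega>: "compact \<Omega>" "full_support \<Omega>" and cont: "continuous_on (\<Omega> \<times> \<Omega>) (\<lambda>(x, y). K x y)"
    and nat: "native_space \<Omega> K H ip"
  shows "cont_rkhs \<Omega> K H ip"
proof
  show "compact \<Omega>" "full_support \<Omega>" "native_space \<Omega> K H ip" by fact+
  interpret ip_space H ip by unfold_locales (use nat in \<open>auto simp: native_space_def\<close>)
  let ?f = "\<lambda>y. zero_ext \<Omega> (\<lambda>t. K t y)"
  have fH: "?f y \<in> H" if "y \<in> \<Omega>" for y using nat that by (simp add: native_space_def)
  have ipf: "ip (?f y) (?f x) = K x y" if "x \<in> \<Omega>" "y \<in> \<Omega>" for x y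
    using nat that by (simp add: native_space_def zero_ext_def)
  fix x and e :: real assume x: "x \<in> \<Omega>" and e: "e > 0"
  have "continuous_on \<Omega> (\<lambda>y. K y y - K x y - K y x + K x x)"
    using x by (intro continuous_intros continuous_on_compose2[OF cont, of \<Omega> "\<lambda>y. (y, y)", simplified]
        continuous_on_compose2[OF cont, of \<Omega> "\<lambda>y. (x, y)", simplified]
        continuous_on_compose2[OF cont, of \<Omega> "\<lambda>y. (y, x)", simplified]) auto
  moreover have "e\<^sup>2 > 0" using e by simp
  ultimately have "\<exists>d>0. \<forall>y\<in>\<Omega>. dist y x < d \<longrightarrow>
      dist (K y y - K x y - K y x + K x x) (K x x - K x x - K x x + K x x) < e\<^sup>2"
    using x unfolding continuous_on_iff by blast
  then obtain d where d: "d > 0"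
    "\<And>y. y \<in> \<Omega> \<Longrightarrow> dist y x < d \<Longrightarrow> \<bar>K y y - K x y - K y x + K x x\<bar> < e\<^sup>2"
    by (auto simp: dist_real_def)
  have "ip_norm ip (?f y - ?f x) < e" if y: "y \<in> \<Omega>" "dist y x < d" for y
  proof -
    have "ip (?f y - ?f x) (?f y - ?f x) = K y y - K x y - K y x + K x x"
      using x y fH by (simp add: ip_linear mem_S ipf)
    then have "ip (?f y - ?f x) (?f y - ?f x) < e\<^sup>2" using d(2)[OF y] by linarith
    then show ?thesis using e real_sqrt_less_mono by (fastforce simp: ip_norm_def)
  qed
  then show "\<exists>d>0. \<forall>y\<in>\<Omega>. dist y x < d \<longrightarrow> ip_norm ip (?f y - ?f x) < e" using d(1) by blast
qed

section \<open>Dimension\<close>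

lemma edim_span_independent:
  assumes "independent B" "finite B"
  shows "edim (span B) = enat (card B)"
  using assms dim_eq_card_independent[OF assms(1)] by (auto simp: edim_def)

lemma edim_finite:
  assumes "edim V = enat n"
  obtains B where "finite B" "V \<subseteq> span B" "dim V = n"
  using assms by (auto simp: edim_def split: if_splits)

section \<open>Optimality of the eigenspaces\<close>

theorem corollary12:
  fixes \<Omega> :: "(real ^ 'd::finite) set"
    and K :: "real ^ 'd \<Rightarrow> real ^ 'd \<Rightarrow> real"
    and H V :: "(real ^ 'd \<Rightarrow> real) set"
    and ip :: "(real ^ 'd \<Rightarrow> real) \<Rightarrow> (real ^ 'd \<Rightarrow> real) \<Rightarrow> real"
    and n :: nat
    and ev evV :: "nat \<Rightarrow> real"
    and \<phi> :: "nat \<Rightarrow> real ^ 'd \<Rightarrow> real"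
  assumes "compact \<Omega>" and "\<Omega> \<noteq> {}" and "full_support \<Omega>"
    and "continuous_on (\<Omega> \<times> \<Omega>) (\<lambda>(x, y). K x y)"
    and "symmetric_kernel \<Omega> K" and "pos_def_kernel \<Omega> K"
    and "native_space \<Omega> K H ip"
    and "closed_subspace H ip V"
    and "1 \<le> n" and "enat n \<le> edim V"
    and "eigenvalue_enum \<Omega> K {1..} ev"
    and "eigenvalue_enum \<Omega> (subspace_kernel \<Omega> K ip V) (dim_index V) evV"
    and "eigenfunctions \<Omega> (subspace_kernel \<Omega> K ip V) V (dim_index V) evV \<phi>"
  shows "ev summable_on {1..} \<and> evV summable_on dim_index V \<and>
    (\<forall>Vn. subspace Vn \<and> Vn \<subseteq> V \<and> edim Vn = enat n \<longrightarrow>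
       power_function H ip Vn \<in> L2 \<Omega> \<and>
       L2_norm \<Omega> (power_function H ip Vn) \<ge>
         sqrt ((\<Sum>\<^sub>\<infinity>j\<in>{1..}. ev j) - (\<Sum>j=1..n. evV j))) \<and>
    (let E = span ((\<lambda>j. sqrt (evV j) *\<^sub>R \<phi> j) ` {1..n}) in
       E \<subseteq> V \<and> edim E = enat n \<and>
       L2_norm \<Omega> (power_function H ip E) =
         sqrt ((\<Sum>\<^sub>\<infinity>j\<in>{1..}. ev j) - (\<Sum>j=1..n. evV j))) \<and>
    (\<forall>Vn. subspace Vn \<and> Vn \<subseteq> V \<and> edim Vn = enat n \<longrightarrow>
       (L2_norm \<Omega> (power_function H ip Vn) =
          sqrt ((\<Sum>\<^sub>\<infinity>j\<in>{1..}. ev j) - (\<Sum>j=1..n. evV j)) \<longleftrightarrow>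
        (\<exists>\<psi>. eigenfunctions \<Omega> (subspace_kernel \<Omega> K ip V) V (dim_index V) evV \<psi> \<and>
             Vn = span (\<psi> ` {1..n})))) \<and>
    power_function H ip V \<in> L2 \<Omega> \<and>
    L2_norm \<Omega> (power_function H ip V) =
      sqrt ((\<Sum>\<^sub>\<infinity>j\<in>{1..}. ev j) - (\<Sum>\<^sub>\<infinity>j\<in>dim_index V. evV j))"
proof -
  interpret H: cont_rkhs \<Omega> K H ip
    by (rule cont_rkhs_of_continuous_kernel) fact+
  define KV where "KV = subspace_kernel \<Omega> K ip V"
  define J where "J = dim_index V"
  note evV = assms(12)[folded KV_def J_def] and \<phi>0 = assms(13)[folded KV_def J_def]
  interpret V: cont_rkhs \<Omega> KV V ip
    unfolding KV_def by (rule H.closed_subspace_rkhs[OF assms(8)])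
  interpret E: eigen_enum V ip "L2_inner \<Omega>" V.embed_const J evV
    by (rule V.eigenvalue_enum_eigen_enum[OF evV])
  have VH: "V \<subseteq> H" and sV: "subspace V" using assms(8) by (auto simp: closed_subspace_def)
  have PV: "H.projectable V" by (rule H.closed_subspace_projectable[OF assms(8)])
  define a where "a = (LINT x|lebesgue_on \<Omega>. K x x)"
  have ev_sum: "(ev has_sum a) {1..}"
    unfolding a_def by (rule H.trace_formula[OF assms(11)])
  have evV_sum: "(evV has_sum (LINT x|lebesgue_on \<Omega>. KV x x)) J"
    by (rule V.trace_formula[OF evV])
  have a: "(\<Sum>\<^sub>\<infinity>j\<in>{1..}. ev j) = a" using ev_sum by (rule infsumI)
  have nJ: "{1..n} \<subseteq> J" "J \<subseteq> {1..}"
    using assms(10) by (auto simp: J_def dim_index_def intro: order_trans[of _ "enat n"])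
  \<comment> \<open>on \<open>V\<close> the eigenfunctions of the integral operator are the eigenvectors of the form\<close>
  note fam_iff = V.eigenfunctions_iff[OF E.eigen_enum_axioms]
  have \<phi>: "E.eigenfamily \<phi>" using \<phi>0 fam_iff by blast
  have norm_span: "power_function H ip (span U) \<in> L2 \<Omega>"
      "L2_norm \<Omega> (power_function H ip (span U)) = sqrt (a - (\<Sum>u\<in>U. L2_inner \<Omega> u u))"
    if "V.ortho U" "finite U" for U
  proof -
    have "H.ortho U" using that(1) VH by (auto simp: H.ortho_def V.ortho_def)
    then show "power_function H ip (span U) \<in> L2 \<Omega>"
      "L2_norm \<Omega> (power_function H ip (span U)) = sqrt (a - (\<Sum>u\<in>U. L2_inner \<Omega> u u))"
      using H.power_function_span that(2) by (auto simp: a_def)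
  qed
  \<comment> \<open>a basis orthonormal in the native space turns \<open>Vn\<close> into the setting of the Ky Fan inequality\<close>
  have basis: "\<exists>U. V.ortho U \<and> finite U \<and> card U = n \<and> span U = Vn"
    if Vn: "subspace Vn \<and> Vn \<subseteq> V \<and> edim Vn = enat n" for Vn
  proof -
    have W: "subspace Vn" "Vn \<subseteq> V" "edim Vn = enat n" using Vn by auto
    obtain B where B: "finite B" "Vn \<subseteq> span B" "dim Vn = n" by (rule edim_finite[OF W(3)])
    have "V.ortho {}" by (simp add: V.ortho_def)
    then obtain U where "V.ortho U" "{} \<subseteq> U" "finite U" "span U = Vn" "card U = dim Vn"
      by (rule V.ortho_extend[OF W(1,2) B(1,2) _ empty_subsetI])
    then show ?thesis using B(3) by blast
  qed
  \<comment> \<open>for leading eigenfunctions the rescaled family itself is the orthonormal basis, with the eigenvalues as squared \<open>L\<^sub>2\<close> norms\<close>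
  have opt: "span (\<psi> ` {1..n}) \<subseteq> V \<and> edim (span (\<psi> ` {1..n})) = enat n \<and>
      span (E.native_basis \<psi> ` {1..n}) = span (\<psi> ` {1..n}) \<and>
      L2_norm \<Omega> (power_function H ip (span (\<psi> ` {1..n}))) = sqrt (a - (\<Sum>j=1..n. evV j))"
    if \<psi>: "E.eigenfamily \<psi>" for \<psi>
  proof -
    define U where "U = E.native_basis \<psi> ` {1..n}"
    have inj: "inj_on (E.native_basis \<psi>) {1..n}"
      using E.inj_native_basis[OF \<psi>] nJ(1) by (rule inj_on_subset)
    have U: "V.ortho U" "finite U" "card U = n"
      using E.ortho_native_basis[OF \<psi> nJ(1)] inj by (auto simp: U_def card_image)
    have sp: "span U = span (\<psi> ` {1..n})"
      unfolding U_def by (rule E.span_native_basis[OF \<psi> nJ(1)])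
    have "(\<Sum>u\<in>U. L2_inner \<Omega> u u) = (\<Sum>j=1..n. evV j)"
      unfolding U_def using E.q_native_basis_self[OF \<psi>] nJ(1)
      by (subst sum.reindex[OF inj]) (auto intro!: sum.cong)
    then show ?thesis
      using norm_span(2)[OF U(1,2)] V.span_ortho_subset[OF U(1)] sp sp[unfolded U_def] U
        edim_span_independent[OF V.ortho_independent[OF U(1)] U(2)]
      by simp
  qed
  have E_eq: "span ((\<lambda>j. sqrt (evV j) *\<^sub>R \<phi> j) ` {1..n}) = span (\<phi> ` {1..n})"
  proof -
    have "(\<lambda>j. sqrt (evV j) *\<^sub>R \<phi> j) ` {1..n} = E.native_basis \<phi> ` {1..n}"
      using nJ(1) by (intro image_cong) (auto simp: E.native_basis_def[OF \<phi>])
    then show ?thesis using opt[OF \<phi>] by simp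
  qed
  have lower: "power_function H ip Vn \<in> L2 \<Omega> \<and>
      sqrt (a - (\<Sum>j=1..n. evV j)) \<le> L2_norm \<Omega> (power_function H ip Vn)"
    if Vn: "subspace Vn \<and> Vn \<subseteq> V \<and> edim Vn = enat n" for Vn
  proof -
    obtain U where U: "V.ortho U" "finite U" "card U = n" "span U = Vn" using basis[OF Vn] by blast
    show ?thesis
      using norm_span[OF U(1,2)] E.Ky_Fan[OF \<phi> assms(9) nJ U(1-3)] U(4) by auto
  qed
  have unique: "L2_norm \<Omega> (power_function H ip Vn) = sqrt (a - (\<Sum>j=1..n. evV j)) \<longleftrightarrow>
      (\<exists>\<psi>. E.eigenfamily \<psi> \<and> Vn = span (\<psi> ` {1..n}))"
    if Vn: "subspace Vn \<and> Vn \<subseteq> V \<and> edim Vn = enat n" for Vn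
  proof
    assume eq: "L2_norm \<Omega> (power_function H ip Vn) = sqrt (a - (\<Sum>j=1..n. evV j))"
    obtain U where U: "V.ortho U" "finite U" "card U = n" "span U = Vn" using basis[OF Vn] by blast
    have "(\<Sum>u\<in>U. L2_inner \<Omega> u u) = (\<Sum>j=1..n. evV j)"
      using eq norm_span(2)[OF U(1,2)] U(4) by simp
    then show "\<exists>\<psi>. E.eigenfamily \<psi> \<and> Vn = span (\<psi> ` {1..n})"
      using E.Ky_Fan_equality[OF \<phi> assms(9) nJ U(1-3)] U(4) by metis
  next
    assume "\<exists>\<psi>. E.eigenfamily \<psi> \<and> Vn = span (\<psi> ` {1..n})"
    then show "L2_norm \<Omega> (power_function H ip Vn) = sqrt (a - (\<Sum>j=1..n. evV j))"
      using opt by blast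
  qed
  have "(LINT x|lebesgue_on \<Omega>. ip (orth_proj ip V (H.feat x)) (orth_proj ip V (H.feat x))) =
      (LINT x|lebesgue_on \<Omega>. KV x x)"
    unfolding KV_def using H.subspace_kernel_diagonal[OF assms(8)]
    by (intro Bochner_Integration.integral_cong) auto
  then have full: "L2_norm \<Omega> (power_function H ip V) = sqrt (a - (\<Sum>\<^sub>\<infinity>j\<in>J. evV j))"
    using H.power_function_L2(2)[OF PV] infsumI[OF evV_sum] by (simp add: a_def)
  show ?thesis
    unfolding a Let_def E_eq KV_def[symmetric] J_def[symmetric] fam_iff
    using ev_sum evV_sum lower opt[OF \<phi>] unique H.power_function_L2(1)[OF PV] full
    by (intro conjI allI impI) (auto simp: has_sum_imp_summable)
qed

end
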